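(* Let $\omega>0$ and $1<p<5$. For $v\in\mathbb{R}$ with $|v|<1$, let $Q_{\omega,v}\in X$ be a non-trivial solution of $$-\partial_{xx}Q+|D_y|Q-iv\,\partial_yQ+\omega Q-|Q|^{p-1}Q=0\quad\text{in }\mathbb{R}^2$$ satisfying $\mathcal{S}_{\omega,v}(Q_{\omega,v})=m_{\omega,v}$, where $$m_{\omega,v}=\inf\{\mathcal{S}_{\omega,v}(u)\mid u\in X\setminus\{0\},\ \mathcal{N}_{\omega,v}(u)=0\}.$$ Then $$\lim_{|v|\to1}\|\partial_xQ_{\omega,v}\|_{L^2}=\lim_{|v|\to1}\|Q_{\omega,v}\|_{L^2}=0.$$
   Context: Functions are complex-valued on $\mathbb{R}^2$ with variables $(x,y)$; $|D_y|^{a}$ is the Fourier multiplier in $y$ with symbol $|\eta|^a$. $X=H^1_xL^2_y(\mathbb{R}^2)\cap L^2_xH^{1/2}_y(\mathbb{R}^2)$ with norm $\|u\|_X=(\|\partial_xu\|_{L^2}^2+\||D_y|^{1/2}u\|_{L^2}^2+\|u\|_{L^2}^2)^{1/2}$. Define on $X$ $$\mathcal{S}_{\omega,v}(u)=\tfrac12\int_{\mathbb{R}^2}\left\{|\partial_xu|^2+(|D_y|u)\overline{u}-iv(\partial_yu)\overline{u}+\omega|u|^2\right\}dxdy-\tfrac1{p+1}\int_{\mathbb{R}^2}|u|^{p+1}dxdy,$$ $$\mathcal{N}_{\omega,v}(u)=\int_{\mathbb{R}^2}\left\{|\partial_xu|^2+(|D_y|u)\overline{u}-iv(\partial_yu)\overline{u}+\omega|u|^2\right\}dxdy-\int_{\mathbb{R}^2}|u|^{p+1}dxdy,$$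 where the terms with $|D_y|$ and $\partial_y$ are understood as quadratic forms on $X$ via the Fourier transform in $y$ (symbols $|\eta|$ and $v\eta$ respectively for $|D_y|$ and $-iv\partial_y$). A function $u\in X$ is a solution of the equation if and only if it is a critical point of $\mathcal{S}_{\omega,v}$ on $X$. *)

theory Defs
  imports "HOL-Analysis.Analysis"
begin

text \<open>
  Elements of \<open>L\<^sup>2(\<real>\<^sup>2)\<close> are represented by Borel functions rather than by classes of functions, so
  "non-zero" means "not almost everywhere zero", see \<open>nontrivial\<close> below.
\<close>

definition square_integrable :: "(real \<times> real \<Rightarrow> complex) \<Rightarrow> bool" where
  "square_integrable f \<longleftrightarrow>
     f \<in> borel_measurable lborel \<and> integrable lborel (\<lambda>z. (cmod (f z))\<^sup>2)"

definition l2_norm :: "(real \<times> real \<Rightarrow> complex) \<Rightarrow> real" where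
  "l2_norm f = sqrt (\<integral>z. (cmod (f z))\<^sup>2 \<partial>lborel)"

definition nontrivial :: "(real \<times> real \<Rightarrow> complex) \<Rightarrow> bool" where
  "nontrivial u \<longleftrightarrow> \<not> (AE z in lborel. u z = 0)"

definition dx :: "(real \<times> real \<Rightarrow> complex) \<Rightarrow> real \<times> real \<Rightarrow> complex" where
  "dx \<phi> z = frechet_derivative \<phi> (at z) (1, 0)"

definition dy :: "(real \<times> real \<Rightarrow> complex) \<Rightarrow> real \<times> real \<Rightarrow> complex" where
  "dy \<phi> z = frechet_derivative \<phi> (at z) (0, 1)"

text \<open>Test functions are of class \<open>C\<^sup>1\<close> with compact support; by mollification, \<open>C\<^sup>\<infinity>\<close> ones give the
  same weak derivative.\<close>

definition test_function :: "(real \<times> real \<Rightarrow> complex) \<Rightarrow> bool" where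
  "test_function \<phi> \<longleftrightarrow>
     (\<forall>z. \<phi> differentiable (at z)) \<and>
     continuous_on UNIV (dx \<phi>) \<and> continuous_on UNIV (dy \<phi>) \<and>
     compact (closure {z. \<phi> z \<noteq> 0})"

definition has_weak_dx ::
    "(real \<times> real \<Rightarrow> complex) \<Rightarrow> (real \<times> real \<Rightarrow> complex) \<Rightarrow> bool" where
  "has_weak_dx u g \<longleftrightarrow> square_integrable g \<and>
     (\<forall>\<phi>. test_function \<phi> \<longrightarrow>
        (\<integral>z. u z * dx \<phi> z \<partial>lborel) = - (\<integral>z. g z * \<phi> z \<partial>lborel))"

text \<open>Both \<open>weak_dx\<close> and \<open>fourier_y\<close> below are determined up to null sets, which none of the integrals
  they enter can see.\<close>

definition weak_dx :: "(real \<times> real \<Rightarrow> complex) \<Rightarrow> real \<times> real \<Rightarrow> complex" where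
  "weak_dx u = (SOME g. has_weak_dx u g)"

text \<open>
  The unitary Fourier--Plancherel transform in \<open>y\<close>: on \<open>L\<^sup>2(\<real>\<^sup>2)\<close>, the limit in \<open>L\<^sup>2\<close> as
  \<open>R \<rightarrow> \<infinity>\<close> of the integrals of \<open>(2\<pi>)\<^bsup>-1/2\<^esup> e\<^bsup>-iy\<eta>\<^esup> u(x,y)\<close> over \<open>\<bar>y\<bar> \<le> R\<close>. With this sign,
  \<open>-i\<partial>\<^sub>y\<close> has symbol \<open>\<eta>\<close>. The extended nonnegative integral
  keeps a divergent integral from counting as zero.
\<close>

definition fourier_y_trunc ::
    "real \<Rightarrow> (real \<times> real \<Rightarrow> complex) \<Rightarrow> real \<times> real \<Rightarrow> complex" where
  "fourier_y_trunc R u = (\<lambda>(x, \<eta>).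
     of_real (1 / sqrt (2 * pi)) * (LINT y:{-R..R}|lborel. cis (- (y * \<eta>)) * u (x, y)))"

definition has_fourier_y ::
    "(real \<times> real \<Rightarrow> complex) \<Rightarrow> (real \<times> real \<Rightarrow> complex) \<Rightarrow> bool" where
  "has_fourier_y u h \<longleftrightarrow> square_integrable h \<and>
     ((\<lambda>R. \<integral>\<^sup>+z. ennreal ((cmod (fourier_y_trunc R u z - h z))\<^sup>2) \<partial>lborel) \<longlongrightarrow> 0) at_top"

definition fourier_y :: "(real \<times> real \<Rightarrow> complex) \<Rightarrow> real \<times> real \<Rightarrow> complex" where
  "fourier_y u = (SOME h. has_fourier_y u h)"

text \<open>The space \<open>X = H\<^sup>1\<^sub>x L\<^sup>2\<^sub>y \<inter> L\<^sup>2\<^sub>x H\<^bsup>1/2\<^esup>\<^sub>y\<close>.\<close>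

definition space_X :: "(real \<times> real \<Rightarrow> complex) set" where
  "space_X = {u. square_integrable u \<and> (\<exists>g. has_weak_dx u g) \<and>
     (\<exists>h. has_fourier_y u h \<and> integrable lborel (\<lambda>(x, \<eta>). \<bar>\<eta>\<bar> * (cmod (h (x, \<eta>)))\<^sup>2))}"

text \<open>
  \<open>form_Dy u w\<close> and \<open>form_dy u w\<close> are the sesquilinear forms of \<open>\<bar>D\<^sub>y\<bar>\<close> and of \<open>-i\<partial>\<^sub>y\<close>, that is
  the pairings of \<open>\<bar>D\<^sub>y\<bar>u\<close> and \<open>-i\<partial>\<^sub>yu\<close> with the conjugate of \<open>w\<close>.
\<close>

definition form_Dy ::
    "(real \<times> real \<Rightarrow> complex) \<Rightarrow> (real \<times> real \<Rightarrow> complex) \<Rightarrow> complex" where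
  "form_Dy u w =
     (\<integral>(x, \<eta>). of_real \<bar>\<eta>\<bar> * fourier_y u (x, \<eta>) * cnj (fourier_y w (x, \<eta>)) \<partial>lborel)"

definition form_dy ::
    "(real \<times> real \<Rightarrow> complex) \<Rightarrow> (real \<times> real \<Rightarrow> complex) \<Rightarrow> complex" where
  "form_dy u w =
     (\<integral>(x, \<eta>). of_real \<eta> * fourier_y u (x, \<eta>) * cnj (fourier_y w (x, \<eta>)) \<partial>lborel)"

text \<open>The quadratic part common to the two functionals; the forms are real on the diagonal, so \<open>Re\<close>
  only adjusts the type.\<close>

definition quadratic_part :: "real \<Rightarrow> real \<Rightarrow> (real \<times> real \<Rightarrow> complex) \<Rightarrow> real" where
  "quadratic_part \<omega> v u =
     (\<integral>z. (cmod (weak_dx u z))\<^sup>2 \<partial>lborel) + Re (form_Dy u u) + v * Re (form_dy u u)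
     + \<omega> * (\<integral>z. (cmod (u z))\<^sup>2 \<partial>lborel)"

definition action_S :: "real \<Rightarrow> real \<Rightarrow> real \<Rightarrow> (real \<times> real \<Rightarrow> complex) \<Rightarrow> real" where
  "action_S p \<omega> v u =
     1 / 2 * quadratic_part \<omega> v u - 1 / (p + 1) * (\<integral>z. cmod (u z) powr (p + 1) \<partial>lborel)"

definition nehari_N :: "real \<Rightarrow> real \<Rightarrow> real \<Rightarrow> (real \<times> real \<Rightarrow> complex) \<Rightarrow> real" where
  "nehari_N p \<omega> v u = quadratic_part \<omega> v u - (\<integral>z. cmod (u z) powr (p + 1) \<partial>lborel)"

definition ground_level :: "real \<Rightarrow> real \<Rightarrow> real \<Rightarrow> real" where
  "ground_level p \<omega> v =
     Inf (action_S p \<omega> v ` {u \<in> space_X. nontrivial u \<and> nehari_N p \<omega> v u = 0})"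

text \<open>
  The equation \<open>-\<partial>\<^sub>x\<^sub>xu + \<bar>D\<^sub>y\<bar>u - iv\<partial>\<^sub>yu + \<omega>u - \<bar>u\<bar>\<^bsup>p-1\<^esup>u = 0\<close> in the dual of \<open>X\<close>. The real part of
  the left-hand side is the derivative of \<open>action_S p \<omega> v\<close> at \<open>u\<close> in direction \<open>w\<close>; as \<open>w\<close> may be
  multiplied by \<open>i\<close>, this says exactly that \<open>u\<close> is a critical point of \<open>action_S p \<omega> v\<close> on \<open>X\<close>.
\<close>

definition is_solution :: "real \<Rightarrow> real \<Rightarrow> real \<Rightarrow> (real \<times> real \<Rightarrow> complex) \<Rightarrow> bool" where
  "is_solution p \<omega> v u \<longleftrightarrow> u \<in> space_X \<and>
     (\<forall>w \<in> space_X.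
        (\<integral>z. weak_dx u z * cnj (weak_dx w z) \<partial>lborel) + form_Dy u w + of_real v * form_dy u w
        + of_real \<omega> * (\<integral>z. u z * cnj (w z) \<partial>lborel)
        - (\<integral>z. of_real (cmod (u z) powr (p - 1)) * u z * cnj (w z) \<partial>lborel) = 0)"

end

theory Submission imports Defs "HOL-Probability.Sinc_Integral" begin

text \<open>
  Why the theorem is true. Testing the equation with \<open>Q\<close> shows that \<open>Q\<close> lies on the Nehari set \<open>N = 0\<close>, where
  the action is a fixed positive multiple of the quadratic part. For \<open>\<bar>v\<bar> < 1\<close> the form of
  \<open>\<bar>D\<^sub>y\<bar> - i v \<partial>\<^sub>y\<close>, whose symbol is \<open>\<bar>\<eta>\<bar> + v \<eta> \<ge> 0\<close>, is nonnegative (lemma \<open>quadratic_part_ge\<close>), so the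
  squares of the \<open>L\<^sup>2\<close> norms of \<open>\<partial>\<^sub>x Q\<close> and of \<open>Q\<close> are bounded by a multiple of the ground level. It remains
  to see that the ground level tends to 0, and for this one trial function on the Nehari set is enough; the
  bound obtained is \<open>O(sqrt (1 - \<bar>v\<bar>))\<close> (lemma \<open>ground_level_le_sqrt\<close>).

  As \<open>\<bar>v\<bar> \<rightarrow> 1\<close> the symbol degenerates on the half-line on which \<open>\<eta>\<close> and \<open>v\<close> have opposite signs: there it is
  \<open>(1 - \<bar>v\<bar>) \<bar>\<eta>\<bar>\<close>. Functions with frequencies in this half-line may therefore be concentrated in \<open>y\<close> at
  almost no cost. Put \<open>r = sqrt (1 - \<bar>v\<bar>)\<close>, let \<open>s = \<plusminus>1\<close> be the sign of \<open>v\<close>, and take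
  \<open>u(x, y) = t q(x) q(y / r) e\<^bsup>- i s y / r\<^sup>2\<^esup>\<close> with \<open>q(x) = max 0 (1 - x\<^sup>2)\<close>. Its frequencies are spread over a width \<open>1 / r\<close>
  around \<open>- s / r\<^sup>2\<close>, where the symbol equals 1, and the tail on the expensive half-line is small because
  the transform of \<open>q\<close> decays quadratically. Hence the whole quadratic part is \<open>O(t\<^sup>2 r)\<close>
  (lemmas \<open>doppler_energy_le\<close> and \<open>quadratic_part_trial\<close>), while the integral of \<open>\<bar>u\<bar>\<^bsup>p+1\<^esup>\<close> is exactly
  proportional to \<open>t\<^bsup>p+1\<^esup> r\<close>. Being on the Nehari set then keeps \<open>t\<close> bounded, and the action is \<open>O(r)\<close>. The
  sharp cutoffs keep all integrals elementary: the truncated Fourier integrals of \<open>u\<close> become stationary.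

  The weak derivative and the Fourier transform are selected by a choice operator. To evaluate the
  functionals at \<open>u\<close> one needs that both are unique up to null sets (lemmas \<open>has_weak_dx_unique\<close> and
  \<open>has_fourier_y_unique\<close>); for the weak derivative this is the fundamental lemma of the calculus of
  variations.
\<close>

section \<open>Functions annihilated by test functions\<close>

text \<open>
  Boxes form an intersection-stable generator of the Borel sets, so vanishing of the integrals of
  \<open>g\<close> passes from boxes to all Borel subsets of a fixed box; the density of the zero measure is zero.
\<close>

lemma AE_zero_if_box_integrals_zero:
  fixes g :: "'a::euclidean_space \<Rightarrow> 'b::{banach, second_countable_topology}"
  assumes int: "\<And>a b. integrable lborel (\<lambda>z. indicat_real (box a b) z *\<^sub>R g z)"
    and zero: "\<And>a b. (\<integral>z. indicat_real (box a b) z *\<^sub>R g z \<partial>lborel) = 0"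
  shows "AE z in lborel. g z = 0"
proof -
  have boxed: "AE z in lborel. indicat_real (box c d) z *\<^sub>R g z = 0" for c d
  proof (rule sigma_finite_measure.density_zero[OF lborel.sigma_finite_measure_axioms int])
    let ?f = "\<lambda>z. indicat_real (box c d) z *\<^sub>R g z"
    fix A :: "'a set" assume "A \<in> sets lborel"
    then have gen: "A \<in> sigma_sets UNIV (range (\<lambda>(a, b). box a b :: 'a set))"
      by (simp add: borel_eq_box)
    have stable: "Int_stable (range (\<lambda>(a, b). box a b :: 'a set))"
      by (auto simp: Int_stable_def box_Int_box)
    have "range (\<lambda>(a, b). box a b :: 'a set) \<subseteq> Pow UNIV"
      by simp
    from stable this gen have "A \<in> sets borel \<and> set_lebesgue_integral lborel A ?f = 0"
    proof (induct rule: sigma_sets_induct_disjoint)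
      case (basic A)
      then obtain a b where A: "A = box a b" by auto
      obtain a' b' where "box a b \<inter> box c d = box a' b'"
        using box_Int_box by blast
      then have "(\<lambda>z. indicat_real A z *\<^sub>R ?f z) = (\<lambda>z. indicat_real (box a' b') z *\<^sub>R g z)"
        by (simp add: A fun_eq_iff indicator_inter_arith flip: \<open>box a b \<inter> box c d = box a' b'\<close>)
      then show ?case
        using zero[of a' b'] by (simp add: set_lebesgue_integral_def A)
    next
      case empty
      then show ?case by (simp add: set_lebesgue_integral_def)
    next
      case (compl A)
      have "set_lebesgue_integral lborel (UNIV - A) ?f
          = (\<integral>z. ?f z - indicat_real A z *\<^sub>R ?f z \<partial>lborel)"
        unfolding set_lebesgue_integral_def
        by (rule Bochner_Integration.integral_cong) (auto simp: indicator_def)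
      also have "\<dots> = (\<integral>z. ?f z \<partial>lborel) - set_lebesgue_integral lborel A ?f"
        unfolding set_lebesgue_integral_def
        by (rule Bochner_Integration.integral_diff[OF int integrable_mult_indicator[OF _ int]])
           (use compl in simp)
      also have "\<dots> = 0"
        using compl zero[of c d] by simp
      finally show ?case using compl by auto
    next
      case (union A)
      have "(\<Union>i. A i) \<in> sets lborel"
        using union(3) by auto
      then have "set_integrable lborel (\<Union>i. A i) ?f"
        unfolding set_integrable_def by (rule integrable_mult_indicator[OF _ int])
      moreover have "A i \<inter> A j = {}" if "i \<noteq> j" for i j
        using union(1) that by (auto simp: disjoint_family_on_def)
      ultimately have "set_lebesgue_integral lborel (\<Union>i. A i) ?f = (\<Sum>i. set_lebesgue_integral lborel (A i) ?f)"
        using union(3) by (intro lebesgue_integral_countable_add) auto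
      then show ?case using union by auto
    qed
    then show "set_lebesgue_integral lborel A ?f = 0" by simp
  qed
  have "AE z in lborel. \<forall>n::nat. indicat_real (box (- (real n *\<^sub>R One)) (real n *\<^sub>R One)) z *\<^sub>R g z = 0"
    unfolding AE_all_countable using boxed by blast
  then show ?thesis
  proof eventually_elim
    case (elim z)
    obtain n :: nat where "z \<in> box (- (real n *\<^sub>R One)) (real n *\<^sub>R One)"
      using UN_box_eq_UNIV[where 'a='a] by blast
    with elim have "indicat_real (box (- (real n *\<^sub>R One)) (real n *\<^sub>R One)) z *\<^sub>R g z = 0"
      "indicat_real (box (- (real n *\<^sub>R One)) (real n *\<^sub>R One)) z = 1"
      by (blast, simp only: indicator_simps)
    then show ?case by simp
  qed
qed

text \<open>
  Squaring removes the kink of the positive part at 0; this is the \<open>C\<^sup>1\<close> building block of the cutoffs below.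
\<close>

lemma has_real_derivative_pos_part_square:
  "((\<lambda>s::real. (max 0 s)\<^sup>2) has_real_derivative 2 * max 0 s) (at s)"
proof -
  consider "s < 0" | "s > 0" | "s = 0" by linarith
  then show ?thesis
  proof cases
    case 1
    have "((\<lambda>s::real. 0) has_real_derivative 2 * max 0 s) (at s)"
      using 1 by simp
    then show ?thesis
      by (rule has_field_derivative_transform_within_open[where S="{..<0}"]) (use 1 in auto)
  next
    case 2
    have "((\<lambda>s::real. s\<^sup>2) has_real_derivative 2 * max 0 s) (at s)"
      using 2 by (auto intro!: derivative_eq_intros)
    then show ?thesis
      by (rule has_field_derivative_transform_within_open[where S="{0<..}"]) (use 2 in auto)
  next
    case 3
    have "((\<lambda>h::real. (max 0 h)\<^sup>2 / h) \<longlongrightarrow> 0) (at 0)"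
    proof (rule Lim_null_comparison)
      show "\<forall>\<^sub>F h::real in at 0. norm ((max 0 h)\<^sup>2 / h) \<le> \<bar>h\<bar>"
        by (intro always_eventually allI) (auto simp: max_def power2_eq_square)
      show "((\<lambda>h::real. \<bar>h\<bar>) \<longlongrightarrow> 0) (at 0)"
        by (intro tendsto_eq_intros) auto
    qed
    then show ?thesis by (simp add: DERIV_def 3)
  qed
qed

text \<open>
  If \<open>k \<ge> 0\<close> is \<open>C\<^sup>1\<close> and positive exactly on \<open>(a, b)\<close>, then \<open>n k / (1 + n k)\<close> is \<open>C\<^sup>1\<close>, is bounded by 1,
  and tends to the indicator of \<open>(a, b)\<close>. For \<open>a < b\<close> take the square of the positive part of
  \<open>(t - a) (b - t)\<close>; otherwise that parabola could be positive outside the empty interval, hence \<open>k = 0\<close>.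
\<close>

lemma C1_cutoff_sequence:
  fixes a b :: real
  obtains \<alpha> \<alpha>' :: "nat \<Rightarrow> real \<Rightarrow> real"
  where "\<And>n t. (\<alpha> n has_real_derivative \<alpha>' n t) (at t)" "\<And>n. continuous_on UNIV (\<alpha>' n)"
    and "\<And>n t. t \<notin> {a<..<b} \<Longrightarrow> \<alpha> n t = 0" "\<And>n t. \<bar>\<alpha> n t\<bar> \<le> 1"
    and "\<And>t. (\<lambda>n. \<alpha> n t) \<longlonglongrightarrow> indicat_real {a<..<b} t"
proof
  define k where "k t = (if a < b then (max 0 ((t - a) * (b - t)))\<^sup>2 else 0)" for t
  define k' where "k' t = (if a < b then 2 * max 0 ((t - a) * (b - t)) * (a + b - 2 * t) else 0)" for t
  have k0: "k t \<ge> 0" for t by (simp add: k_def)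
  have kd: "(k has_real_derivative k' t) (at t)" for t
  proof (cases "a < b")
    case True
    have "((\<lambda>t. (max 0 ((t - a) * (b - t)))\<^sup>2) has_real_derivative
        2 * max 0 ((t - a) * (b - t)) * (a + b - 2 * t)) (at t)"
      by (rule DERIV_chain2[OF has_real_derivative_pos_part_square])
         (auto intro!: derivative_eq_intros)
    then show ?thesis using True by (simp add: k_def[abs_def] k'_def)
  next
    case False
    then show ?thesis by (simp add: k_def[abs_def] k'_def)
  qed
  have kc: "continuous_on UNIV k"
    using kd by (meson DERIV_isCont continuous_at_imp_continuous_on)
  have k'c: "continuous_on UNIV k'"
    unfolding k'_def[abs_def] by (cases "a < b") (auto intro!: continuous_intros)
  have kz: "k t = 0" if "t \<notin> {a<..<b}" for t
    using that by (auto simp: k_def max_def zero_le_mult_iff not_less mult_le_0_iff)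
  have kp: "k t > 0" if "t \<in> {a<..<b}" for t
    using that by (auto simp: k_def max_def not_le)
  define \<alpha> where "\<alpha> n t = real n * k t / (1 + real n * k t)" for n t
  define \<alpha>' where "\<alpha>' n t = real n * k' t / (1 + real n * k t)\<^sup>2" for n t
  have pos: "1 + real n * k t > 0" for n t
    using k0[of t] by (simp add: add_pos_nonneg)
  note nz = pos[THEN less_imp_neq, THEN not_sym]
  show "(\<alpha> n has_real_derivative \<alpha>' n t) (at t)" for n t
    unfolding \<alpha>_def[abs_def] \<alpha>'_def
    by (rule derivative_eq_intros kd nz refl)+ (use nz[of n t] in \<open>simp add: field_simps power2_eq_square\<close>)
  show "continuous_on UNIV (\<alpha>' n)" for n
    unfolding \<alpha>'_def[abs_def] by (intro continuous_intros kc k'c) (use nz in auto)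
  show "\<alpha> n t = 0" if "t \<notin> {a<..<b}" for n t
    using kz[OF that] by (simp add: \<alpha>_def)
  show "\<bar>\<alpha> n t\<bar> \<le> 1" for n t
    using pos[of n t] k0[of t] by (simp add: \<alpha>_def abs_mult)
  show "(\<lambda>n. \<alpha> n t) \<longlonglongrightarrow> indicat_real {a<..<b} t" for t
  proof (cases "t \<in> {a<..<b}")
    case False
    then show ?thesis using kz[OF False] by (auto simp: \<alpha>_def)
  next
    case True
    have "(\<lambda>n. real n * k t) = (\<lambda>n. k t * real n)" by auto
    then have "filterlim (\<lambda>n. 1 + real n * k t) at_top sequentially"
      using filterlim_tendsto_pos_mult_at_top[OF tendsto_const kp[OF True] filterlim_real_sequentially]
      by (intro filterlim_tendsto_add_at_top[OF tendsto_const]) simp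
    then have "(\<lambda>n. 1 - inverse (1 + real n * k t)) \<longlonglongrightarrow> 1 - 0"
      by (intro tendsto_diff tendsto_const filterlim_compose[OF tendsto_inverse_0]
            filterlim_mono[OF _ at_top_le_at_infinity order_refl])
    moreover have "1 - inverse (1 + real n * k t) = \<alpha> n t" for n
      using nz[of n t] by (simp add: \<alpha>_def field_simps)
    ultimately show ?thesis using True by simp
  qed
qed

lemma test_function_product:
  fixes \<alpha> \<beta> \<alpha>' \<beta>' :: "real \<Rightarrow> real"
  assumes "\<And>t. (\<alpha> has_real_derivative \<alpha>' t) (at t)" "\<And>t. (\<beta> has_real_derivative \<beta>' t) (at t)"
    and "continuous_on UNIV \<alpha>'" "continuous_on UNIV \<beta>'"
    and "\<And>t. t \<notin> {a<..<b} \<Longrightarrow> \<alpha> t = 0" "\<And>t. t \<notin> {c<..<d} \<Longrightarrow> \<beta> t = 0"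
  shows "test_function (\<lambda>z. of_real (\<alpha> (fst z) * \<beta> (snd z)))"
proof -
  let ?\<phi> = "\<lambda>z. complex_of_real (\<alpha> (fst z) * \<beta> (snd z))"
  have cont: "continuous_on UNIV \<alpha>" "continuous_on UNIV \<beta>"
    using assms(1,2) by (meson DERIV_isCont continuous_at_imp_continuous_on)+
  have der: "(?\<phi> has_derivative (\<lambda>h. of_real (\<alpha> (fst z) * (snd h * \<beta>' (snd z)) + fst h * \<alpha>' (fst z) * \<beta> (snd z)))) (at z)" for z
  proof -
    have "((\<lambda>z::real\<times>real. \<alpha> (fst z)) has_derivative (\<lambda>h. fst h * \<alpha>' (fst z))) (at z)"
      using has_derivative_compose[OF has_derivative_fst[OF has_derivative_ident]
          assms(1)[unfolded has_field_derivative_def, of "fst z"], of UNIV]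
      by (simp add: mult.commute)
    moreover have "((\<lambda>z::real\<times>real. \<beta> (snd z)) has_derivative (\<lambda>h. snd h * \<beta>' (snd z))) (at z)"
      using has_derivative_compose[OF has_derivative_snd[OF has_derivative_ident]
          assms(2)[unfolded has_field_derivative_def, of "snd z"], of UNIV]
      by (simp add: mult.commute)
    ultimately show ?thesis
      by (intro has_derivative_of_real has_derivative_mult)
  qed
  note frd = frechet_derivative_at[OF der, symmetric]
  show ?thesis
    unfolding test_function_def
  proof (intro conjI allI)
    show "?\<phi> differentiable (at z)" for z
      using der[of z] by (rule differentiableI)
    have c2: "continuous_on UNIV (\<lambda>z::real\<times>real. h (fst z))" "continuous_on UNIV (\<lambda>z::real\<times>real. h (snd z))"
      if "continuous_on UNIV h" for h :: "real \<Rightarrow> real"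
      by (rule continuous_on_compose2[OF that]; auto intro!: continuous_intros)+
    show "continuous_on UNIV (dx ?\<phi>)" "continuous_on UNIV (dy ?\<phi>)"
      unfolding dx_def[abs_def] dy_def[abs_def] frd
      by (auto intro!: continuous_intros c2 cont assms)
    have "{z. ?\<phi> z \<noteq> 0} \<subseteq> cbox (a, c) (b, d)"
      using assms(5,6) by (fastforce simp: cbox_Pair_eq)
    then show "compact (closure {z. ?\<phi> z \<noteq> 0})"
      by (meson bounded_cbox bounded_subset compact_closure)
  qed
qed

text \<open>
  Square integrable functions are locally integrable, because \<open>x \<le> 1 + x\<^sup>2\<close>.
\<close>

lemma square_integrable_box:
  assumes "square_integrable g"
  shows "integrable lborel (\<lambda>z. indicat_real (box a b) z *\<^sub>R g z)"
proof (rule Bochner_Integration.integrable_bound)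
  have [measurable]: "g \<in> borel_measurable lborel"
    using assms by (simp add: square_integrable_def)
  show "(\<lambda>z. indicat_real (box a b) z *\<^sub>R g z) \<in> borel_measurable lborel" by measurable
  show "integrable lborel (\<lambda>z. indicat_real (box a b) z + (cmod (g z))\<^sup>2)"
    using assms by (simp add: square_integrable_def emeasure_lborel_box_eq)
  have "x \<le> 1 + x\<^sup>2" for x :: real
    using zero_le_power2[of "x - 1/2"] by (simp add: power2_eq_square algebra_simps)
  then show "AE z in lborel. norm (indicat_real (box a b) z *\<^sub>R g z)
      \<le> norm (indicat_real (box a b) z + (cmod (g z))\<^sup>2)"
    by (intro AE_I2) (auto simp: indicator_def)
qed

text \<open>
  The fundamental lemma of the calculus of variations: products of one-dimensional cutoffs are test
  functions that converge boundedly to the indicator of a box.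
\<close>

lemma AE_zero_if_annihilates_test_functions:
  assumes g: "square_integrable g"
    and zero: "\<And>\<phi>. test_function \<phi> \<Longrightarrow> (\<integral>z. g z * \<phi> z \<partial>lborel) = 0"
  shows "AE z in lborel. g z = 0"
proof (rule AE_zero_if_box_integrals_zero)
  show "integrable lborel (\<lambda>z. indicat_real (box a b) z *\<^sub>R g z)" for a b
    by (rule square_integrable_box[OF g])
  fix p q :: "real \<times> real"
  obtain a c b d where p: "p = (a, c)" and q: "q = (b, d)" by fastforce
  obtain \<alpha> \<alpha>' where \<alpha>: "\<And>n t. (\<alpha> n has_real_derivative \<alpha>' n t) (at t)" "\<And>n. continuous_on UNIV (\<alpha>' n)"
    "\<And>n t. t \<notin> {a<..<b} \<Longrightarrow> \<alpha> n t = 0" "\<And>n t. \<bar>\<alpha> n t\<bar> \<le> 1"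
    "\<And>t. (\<lambda>n. \<alpha> n t) \<longlonglongrightarrow> indicat_real {a<..<b} t"
    by (rule C1_cutoff_sequence[of a b]) metis
  obtain \<beta> \<beta>' where \<beta>: "\<And>n t. (\<beta> n has_real_derivative \<beta>' n t) (at t)" "\<And>n. continuous_on UNIV (\<beta>' n)"
    "\<And>n t. t \<notin> {c<..<d} \<Longrightarrow> \<beta> n t = 0" "\<And>n t. \<bar>\<beta> n t\<bar> \<le> 1"
    "\<And>t. (\<lambda>n. \<beta> n t) \<longlonglongrightarrow> indicat_real {c<..<d} t"
    by (rule C1_cutoff_sequence[of c d]) metis
  let ?\<phi> = "\<lambda>n z. complex_of_real (\<alpha> n (fst z) * \<beta> n (snd z))"
  have [measurable]: "g \<in> borel_measurable lborel"
    using g by (simp add: square_integrable_def)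
  have [measurable]: "\<alpha> n \<in> borel_measurable borel" "\<beta> n \<in> borel_measurable borel" for n
    using \<alpha>(1) \<beta>(1) by (meson DERIV_isCont continuous_at_imp_continuous_on borel_measurable_continuous_onI)+
  have [measurable]: "?\<phi> n \<in> borel_measurable lborel" for n
    by (subst lborel_prod[symmetric]) measurable
  have zbox: "z \<in> box p q \<longleftrightarrow> fst z \<in> {a<..<b} \<and> snd z \<in> {c<..<d}" for z
    by (cases z) (auto simp: p q box_def Basis_prod_def)
  have "(\<lambda>n. \<integral>z. g z * ?\<phi> n z \<partial>lborel) \<longlonglongrightarrow> (\<integral>z. indicat_real (box p q) z *\<^sub>R g z \<partial>lborel)"
  proof (rule integral_dominated_convergence)
    show "integrable lborel (\<lambda>z. norm (indicat_real (box p q) z *\<^sub>R g z))"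
      by (intro integrable_norm square_integrable_box[OF g])
    show "AE z in lborel. (\<lambda>n. g z * ?\<phi> n z) \<longlonglongrightarrow> indicat_real (box p q) z *\<^sub>R g z"
    proof (intro AE_I2)
      fix z
      have "(\<lambda>n. g z * ?\<phi> n z) \<longlonglongrightarrow> g z * of_real (indicat_real {a<..<b} (fst z) * indicat_real {c<..<d} (snd z))"
        by (intro tendsto_intros \<alpha>(5) \<beta>(5))
      also have "g z * of_real (indicat_real {a<..<b} (fst z) * indicat_real {c<..<d} (snd z))
          = indicat_real (box p q) z *\<^sub>R g z"
        by (auto simp: indicator_def zbox)
      finally show "(\<lambda>n. g z * ?\<phi> n z) \<longlonglongrightarrow> indicat_real (box p q) z *\<^sub>R g z" .
    qed
    show "AE z in lborel. norm (g z * ?\<phi> n z) \<le> norm (indicat_real (box p q) z *\<^sub>R g z)" for n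
    proof (intro AE_I2)
      fix z
      show "norm (g z * ?\<phi> n z) \<le> norm (indicat_real (box p q) z *\<^sub>R g z)"
      proof (cases "z \<in> box p q")
        case True
        have "\<bar>\<alpha> n (fst z)\<bar> * \<bar>\<beta> n (snd z)\<bar> \<le> 1"
          using \<alpha>(4)[of n "fst z"] \<beta>(4)[of n "snd z"] by (simp add: mult_le_one)
        then show ?thesis using True
          by (simp add: norm_mult abs_mult mult_left_le)
      next
        case False
        then have "?\<phi> n z = 0"
          using \<alpha>(3)[of "fst z"] \<beta>(3)[of "snd z"] by (auto simp: zbox)
        then show ?thesis by (simp only: mult_zero_right norm_zero norm_ge_zero)
      qed
    qed
  qed measurable
  moreover have "(\<integral>z. g z * ?\<phi> n z \<partial>lborel) = 0" for n
    by (rule zero, rule test_function_product[OF \<alpha>(1) \<beta>(1) \<alpha>(2) \<beta>(2) \<alpha>(3) \<beta>(3)])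
  ultimately show "(\<integral>z. indicat_real (box p q) z *\<^sub>R g z \<partial>lborel) = 0"
    by (simp only: LIMSEQ_const_iff)
qed

section \<open>Uniqueness of weak derivatives and Fourier transforms\<close>

lemma square_norm_add_le: "(norm (a + b))\<^sup>2 \<le> 2 * (norm a)\<^sup>2 + 2 * (norm b)\<^sup>2"
  for a b :: "'a::real_normed_vector"
proof -
  have "(norm (a + b))\<^sup>2 \<le> (norm a + norm b)\<^sup>2"
    by (intro power_mono norm_triangle_ineq) simp
  also have "\<dots> \<le> 2 * (norm a)\<^sup>2 + 2 * (norm b)\<^sup>2"
    using zero_le_power2[of "norm a - norm b"] by (simp add: power2_eq_square algebra_simps)
  finally show ?thesis .
qed

lemma square_integrable_diff:
  assumes f: "square_integrable f" and g: "square_integrable g"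
  shows "square_integrable (\<lambda>z. f z - g z)"
proof -
  have [measurable]: "f \<in> borel_measurable lborel" "g \<in> borel_measurable lborel"
    using f g by (auto simp: square_integrable_def)
  have "integrable lborel (\<lambda>z. (cmod (f z - g z))\<^sup>2)"
  proof (rule Bochner_Integration.integrable_bound)
    show "integrable lborel (\<lambda>z. 2 * (cmod (f z))\<^sup>2 + 2 * (cmod (g z))\<^sup>2)"
      using f g by (auto simp: square_integrable_def)
    show "AE z in lborel. norm ((cmod (f z - g z))\<^sup>2) \<le> norm (2 * (cmod (f z))\<^sup>2 + 2 * (cmod (g z))\<^sup>2)"
      using square_norm_add_le[of "f z" "- g z" for z] by simp
  qed measurable
  then show ?thesis by (simp add: square_integrable_def)
qed

lemma integrable_times_test_function:
  assumes g: "square_integrable g" and \<phi>: "test_function \<phi>"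
  shows "integrable lborel (\<lambda>z. g z * \<phi> z)"
proof -
  have cont: "continuous_on UNIV \<phi>"
    using \<phi> by (meson continuous_at_imp_continuous_on differentiable_imp_continuous_within test_function_def)
  have [measurable]: "g \<in> borel_measurable lborel"
    using g by (simp add: square_integrable_def)
  have [measurable]: "\<phi> \<in> borel_measurable borel"
    by (rule borel_measurable_continuous_onI[OF cont])
  let ?K = "closure {z. \<phi> z \<noteq> 0}"
  have K: "compact ?K" using \<phi> by (simp add: test_function_def)
  have int: "integrable lborel (\<lambda>z. indicat_real ?K z *\<^sub>R (cmod (\<phi> z))\<^sup>2)"
    by (rule borel_integrable_compact[OF K]) (intro continuous_intros continuous_on_subset[OF cont] subset_UNIV)
  have "(\<lambda>z. indicat_real ?K z *\<^sub>R (cmod (\<phi> z))\<^sup>2) = (\<lambda>z. (cmod (\<phi> z))\<^sup>2)"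
    using closure_subset[of "{z. \<phi> z \<noteq> 0}"] by (auto simp: fun_eq_iff indicator_def)
  with int have int: "integrable lborel (\<lambda>z. (cmod (\<phi> z))\<^sup>2)" by simp
  show ?thesis
  proof (rule Bochner_Integration.integrable_bound)
    show "integrable lborel (\<lambda>z. (cmod (g z))\<^sup>2 + (cmod (\<phi> z))\<^sup>2)"
      using g int by (auto simp: square_integrable_def)
    have "a * b \<le> a\<^sup>2 + b\<^sup>2" if "a \<ge> 0" "b \<ge> 0" for a b :: real
      using sum_squares_bound[of a b] mult_nonneg_nonneg[OF that] by simp
    then show "AE z in lborel. norm (g z * \<phi> z) \<le> norm ((cmod (g z))\<^sup>2 + (cmod (\<phi> z))\<^sup>2)"
      by (intro AE_I2) (simp add: norm_mult)
  qed measurable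
qed

text \<open>
  The chosen \<open>weak_dx u\<close> is opaque; uniqueness up to null sets lets every integral that contains it be
  computed from any weak derivative that can be written down. The same applies to \<open>fourier_y\<close> below.
\<close>

lemma has_weak_dx_unique:
  assumes g: "has_weak_dx u g" and h: "has_weak_dx u h"
  shows "AE z in lborel. g z = h z"
proof -
  have sq: "square_integrable g" "square_integrable h"
    using g h by (auto simp: has_weak_dx_def)
  have "AE z in lborel. g z - h z = 0"
  proof (rule AE_zero_if_annihilates_test_functions)
    show "square_integrable (\<lambda>z. g z - h z)"
      by (rule square_integrable_diff[OF sq])
    fix \<phi> assume \<phi>: "test_function \<phi>"
    have "(\<integral>z. (g z - h z) * \<phi> z \<partial>lborel) = (\<integral>z. g z * \<phi> z \<partial>lborel) - (\<integral>z. h z * \<phi> z \<partial>lborel)"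
      using integrable_times_test_function[OF sq(1) \<phi>] integrable_times_test_function[OF sq(2) \<phi>]
      by (simp add: left_diff_distrib)
    also have "\<dots> = 0"
      using g h \<phi> by (auto simp: has_weak_dx_def dest!: spec[of _ \<phi>])
    finally show "(\<integral>z. (g z - h z) * \<phi> z \<partial>lborel) = 0" .
  qed
  then show ?thesis by simp
qed

lemma weak_dx_AE:
  assumes "has_weak_dx u g"
  shows "AE z in lborel. weak_dx u z = g z"
  unfolding weak_dx_def
  by (rule has_weak_dx_unique[OF someI[where P="has_weak_dx u", OF assms] assms])

lemma measurable_fourier_y_trunc:
  assumes [measurable]: "u \<in> borel_measurable borel"
  shows "fourier_y_trunc R u \<in> borel_measurable borel"
proof -
  have [measurable]: "u \<in> borel_measurable (borel \<Otimes>\<^sub>M borel)"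
    using assms by (simp add: borel_prod)
  have "(\<lambda>(x, \<eta>). of_real (1 / sqrt (2 * pi)) * (LINT y:{-R..R}|lborel. cis (- (y * \<eta>)) * u (x, y)))
      \<in> borel_measurable (borel \<Otimes>\<^sub>M borel)"
    unfolding set_lebesgue_integral_def cis_conv_exp by measurable
  then show ?thesis by (simp add: fourier_y_trunc_def borel_prod)
qed

text \<open>
  Two \<open>L\<^sup>2\<close> limits of the same truncated integrals agree. Measurability of the truncations is needed since
  the distance of the limits is estimated by splitting a nonnegative integral of a sum.
\<close>

lemma has_fourier_y_unique:
  assumes [measurable]: "u \<in> borel_measurable borel"
    and g: "has_fourier_y u g" and h: "has_fourier_y u h"
  shows "AE z in lborel. g z = h z"
proof -
  let ?F = "\<lambda>R. fourier_y_trunc R u"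
  let ?I = "\<lambda>R f. \<integral>\<^sup>+z. ennreal ((cmod (?F R z - f z))\<^sup>2) \<partial>lborel"
  have [measurable]: "g \<in> borel_measurable borel" "h \<in> borel_measurable borel"
    using g h by (auto simp: has_fourier_y_def square_integrable_def)
  note [measurable] = measurable_fourier_y_trunc[OF assms(1)]
  have le: "(\<integral>\<^sup>+z. ennreal ((cmod (g z - h z))\<^sup>2) \<partial>lborel) \<le> 2 * ?I R g + 2 * ?I R h" for R
  proof -
    have "(\<integral>\<^sup>+z. ennreal ((cmod (g z - h z))\<^sup>2) \<partial>lborel)
        \<le> (\<integral>\<^sup>+z. 2 * ennreal ((cmod (?F R z - g z))\<^sup>2) + 2 * ennreal ((cmod (?F R z - h z))\<^sup>2) \<partial>lborel)"
    proof (rule nn_integral_mono)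
      fix z
      have "(cmod (g z - h z))\<^sup>2 \<le> 2 * (cmod (?F R z - g z))\<^sup>2 + 2 * (cmod (?F R z - h z))\<^sup>2"
        using square_norm_add_le[of "g z - ?F R z" "?F R z - h z"] by (simp add: norm_minus_commute)
      then have "ennreal ((cmod (g z - h z))\<^sup>2)
          \<le> ennreal (2 * (cmod (?F R z - g z))\<^sup>2 + 2 * (cmod (?F R z - h z))\<^sup>2)"
        by (rule ennreal_leI)
      then show "ennreal ((cmod (g z - h z))\<^sup>2)
          \<le> 2 * ennreal ((cmod (?F R z - g z))\<^sup>2) + 2 * ennreal ((cmod (?F R z - h z))\<^sup>2)"
        by (simp add: ennreal_plus ennreal_mult' del: ennreal_plus[symmetric])
    qed
    also have "\<dots> = 2 * ?I R g + 2 * ?I R h"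
      by (simp add: nn_integral_add nn_integral_cmult)
    finally show ?thesis .
  qed
  have "((\<lambda>R. 2 * ?I R g + 2 * ?I R h) \<longlongrightarrow> 2 * 0 + 2 * 0) at_top"
    using g h unfolding has_fourier_y_def
    by (intro tendsto_add ennreal_tendsto_cmult) auto
  then have "(\<integral>\<^sup>+z. ennreal ((cmod (g z - h z))\<^sup>2) \<partial>lborel) \<le> 2 * 0 + 2 * 0"
    by (rule tendsto_lowerbound) (simp_all add: le)
  then have "AE z in lborel. ennreal ((cmod (g z - h z))\<^sup>2) = 0"
    by (simp add: nn_integral_0_iff_AE)
  then show ?thesis by eventually_elim simp
qed

lemma fourier_y_AE:
  assumes "u \<in> borel_measurable borel" "has_fourier_y u h"
  shows "AE z in lborel. fourier_y u z = h z"
  unfolding fourier_y_def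
  by (rule has_fourier_y_unique[OF assms(1) someI[where P="has_fourier_y u", OF assms(2)] assms(2)])

lemma
  fixes f g :: "real \<Rightarrow> 'b::{banach, real_normed_algebra, second_countable_topology}"
  assumes f: "integrable lborel f" and g: "integrable lborel g"
  shows integrable_lborel_times: "integrable lborel (\<lambda>z. f (fst z) * g (snd z))"
    and integral_lborel_times:
      "(\<integral>z. f (fst z) * g (snd z) \<partial>lborel) = (\<integral>x. f x \<partial>lborel) * (\<integral>y. g y \<partial>lborel)"
proof -
  have [measurable]: "f \<in> borel_measurable borel" "g \<in> borel_measurable borel"
    using f g by auto
  have meas [measurable]: "(\<lambda>z. f (fst z) * g (snd z)) \<in> borel_measurable (lborel \<Otimes>\<^sub>M lborel)"
    by measurable
  have int: "integrable (lborel \<Otimes>\<^sub>M lborel) (\<lambda>z. f (fst z) * g (snd z))"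
  proof (rule Bochner_Integration.integrable_bound)
    show "integrable (lborel \<Otimes>\<^sub>M lborel) (\<lambda>z. norm (f (fst z)) * norm (g (snd z)))"
    proof (rule lborel_pair.Fubini_integrable)
      show "AE x in lborel. integrable lborel (\<lambda>y. norm (f (fst (x, y))) * norm (g (snd (x, y))))"
        using g by (intro AE_I2) auto
      show "integrable lborel (\<lambda>x. \<integral>y. norm (norm (f (fst (x, y))) * norm (g (snd (x, y)))) \<partial>lborel)"
        using f by (simp add: abs_mult)
    qed measurable
    show "AE z in lborel \<Otimes>\<^sub>M lborel. norm (f (fst z) * g (snd z)) \<le> norm (norm (f (fst z)) * norm (g (snd z)))"
      by (simp add: norm_mult_ineq)
  qed (fact meas)
  then show "integrable lborel (\<lambda>z. f (fst z) * g (snd z))"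
    by (simp add: lborel_prod)
  have "(\<integral>z. f (fst z) * g (snd z) \<partial>lborel) = (\<integral>z. f (fst z) * g (snd z) \<partial>(lborel \<Otimes>\<^sub>M lborel))"
    by (simp add: lborel_prod)
  also have "\<dots> = (\<integral>x. (\<integral>y. f x * g y \<partial>lborel) \<partial>lborel)"
    using lborel_pair.integral_fst'[OF int] by simp
  also have "\<dots> = (\<integral>x. f x \<partial>lborel) * (\<integral>y. g y \<partial>lborel)"
    using f g by simp
  finally show "(\<integral>z. f (fst z) * g (snd z) \<partial>lborel) = (\<integral>x. f x \<partial>lborel) * (\<integral>y. g y \<partial>lborel)" .
qed

section \<open>The profile and the decay of its Fourier transform\<close>

lemma integrable_compact_support:
  fixes f :: "'a::euclidean_space \<Rightarrow> 'b::{banach, second_countable_topology}"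
  assumes "compact K" "continuous_on K f" "\<And>z. z \<notin> K \<Longrightarrow> f z = 0"
  shows "integrable lborel f"
proof -
  have "(\<lambda>z. indicat_real K z *\<^sub>R f z) = f"
    using assms(3) by (auto simp: fun_eq_iff indicator_def)
  with borel_integrable_compact[OF assms(1,2)] show ?thesis by simp
qed

text \<open>
  The parabola \<open>1 - t\<^sup>2\<close> cut off at its zeros: its derivative has jumps but is still
  square integrable, and its Fourier transform decays like \<open>\<tau>\<^bsup>-2\<^esup>\<close>, which is enough for a finite
  \<open>H\<^bsup>1/2\<^esup>\<close> norm.
\<close>

definition bump :: "real \<Rightarrow> real" where
  "bump t = max 0 (1 - t\<^sup>2)"

text \<open>
  The weak derivative of \<open>bump\<close>; at the two corners, where there is no classical derivative, it is given
  the one-sided derivative from inside, so that it is continuous on the closed support.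
\<close>

definition bump' :: "real \<Rightarrow> real" where
  "bump' t = (if \<bar>t\<bar> \<le> 1 then - 2 * t else 0)"

definition bump_hat :: "real \<Rightarrow> complex" where
  "bump_hat \<tau> = (\<integral>y. cis (- (y * \<tau>)) * of_real (bump y) \<partial>lborel)"

lemma bump_nonneg [simp]: "0 \<le> bump t"
  by (simp add: bump_def)

lemma bump_le_1: "bump t \<le> 1"
  by (simp add: bump_def)

lemma bump_eq_0: "1 \<le> \<bar>t\<bar> \<Longrightarrow> bump t = 0"
  using one_le_power[of "\<bar>t\<bar>" 2] by (simp add: bump_def)

lemma bump_eq: "\<bar>t\<bar> \<le> 1 \<Longrightarrow> bump t = 1 - t\<^sup>2"
  using power_le_one[of "\<bar>t\<bar>" 2] by (simp add: bump_def)

lemma continuous_on_bump [continuous_intros]: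
  "continuous_on S f \<Longrightarrow> continuous_on S (\<lambda>z. bump (f z))"
  unfolding bump_def by (intro continuous_intros)

lemma measurable_bump [measurable]: "bump \<in> borel_measurable borel"
  by (rule borel_measurable_continuous_onI) (intro continuous_intros)

lemma measurable_bump' [measurable]: "bump' \<in> borel_measurable borel"
  unfolding bump'_def by measurable

lemma measurable_bump_hat [measurable]: "bump_hat \<in> borel_measurable borel"
  unfolding bump_hat_def cis_conv_exp by measurable

lemma integrable_bump_power: "0 < n \<Longrightarrow> integrable lborel (\<lambda>t. bump t ^ n)"
  by (rule integrable_compact_support[of "{-1..1}"]) (auto intro!: continuous_intros bump_eq_0)

lemma integrable_bump: "integrable lborel bump"
  using integrable_bump_power[of 1] by simp

lemma integrable_bump_powr: "0 < q \<Longrightarrow> integrable lborel (\<lambda>t. bump t powr q)"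
  by (rule integrable_compact_support[of "{-1..1}"])
     (auto intro!: continuous_intros continuous_on_powr' bump_eq_0)

lemma integrable_bump'_square: "integrable lborel (\<lambda>t. (bump' t)\<^sup>2)"
proof (rule integrable_compact_support[of "{-1..1}"])
  have "continuous_on {-1..1} (\<lambda>t::real. (- 2 * t)\<^sup>2)" by (intro continuous_intros)
  then show "continuous_on {-1..1} (\<lambda>t. (bump' t)\<^sup>2)"
    by (rule continuous_on_eq) (auto simp: bump'_def)
qed (auto simp: bump'_def)

lemma integral_bump_powr_pos:
  assumes "0 < q"
  shows "0 < (\<integral>t. bump t powr q \<partial>lborel)"
proof -
  have "(\<integral>t. bump t powr q \<partial>lborel) \<noteq> 0"
  proof
    assume "(\<integral>t. bump t powr q \<partial>lborel) = 0"
    then have "AE t in lborel. bump t powr q = 0"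
      using integral_nonneg_eq_0_iff_AE[OF integrable_bump_powr[OF assms]] by simp
    then have "AE t in lborel. t \<notin> {-1<..<1::real}"
    proof (rule eventually_mono)
      fix t :: real assume "bump t powr q = 0"
      then have "\<not> t\<^sup>2 < 1" by (simp add: bump_def)
      then show "t \<notin> {-1<..<1}" using abs_square_less_1[of t] by auto
    qed
    then have "{-1<..<1::real} \<in> null_sets lborel"
      by (subst AE_iff_null_sets) simp_all
    then show False by (simp add: null_sets_def)
  qed
  then show ?thesis by (simp add: less_le)
qed

text \<open>
  For large \<open>\<bar>\<tau>\<bar>\<close> two integrations by parts, written as an explicit antiderivative, gain \<open>\<tau>\<^bsup>-2\<^esup>\<close>: the
  first boundary term vanishes because \<open>bump\<close> does at \<open>\<plusminus>1\<close>. For small \<open>\<bar>\<tau>\<bar>\<close> the trivial bound 2, the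
  length of the support, is enough.
\<close>

lemma norm_bump_hat_le: "cmod (bump_hat \<tau>) \<le> 16 / (1 + \<tau>\<^sup>2)"
proof (cases "\<bar>\<tau>\<bar> \<le> 1")
  case True
  have "cmod (bump_hat \<tau>) \<le> (\<integral>y. norm (cis (- (y * \<tau>)) * of_real (bump y)) \<partial>lborel)"
    unfolding bump_hat_def by (rule integral_norm_bound)
  also have "\<dots> = (\<integral>y. bump y \<partial>lborel)"
    by (simp add: norm_mult)
  also have "\<dots> \<le> (\<integral>y. indicat_real {-1..1::real} y \<partial>lborel)"
  proof (rule integral_mono[OF integrable_bump])
    show "integrable lborel (indicat_real {-1..1::real})"
      by (rule integrable_real_indicator) simp_all
  qed (auto simp: indicator_def bump_le_1 bump_eq_0)
  also have "\<dots> = 2" by simp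
  also have "2 \<le> 16 / (1 + \<tau>\<^sup>2)"
    using abs_square_le_1[of \<tau>] True by (simp add: field_simps add_pos_nonneg)
  finally show ?thesis .
next
  case False
  then have \<tau>: "\<tau> \<noteq> 0" by auto
  define w where "w = \<i> * complex_of_real \<tau>"
  have w: "w \<noteq> 0" "cmod w = \<bar>\<tau>\<bar>" using \<tau> by (auto simp: w_def norm_mult)
  \<comment> \<open>The polynomial factor solves \<open>P' - w P = 1 - y\<^sup>2\<close>.\<close>
  define F where "F y = exp (- (of_real y * w)) * ((2 / w ^ 3 - 1 / w) + (2 / w ^ 2) * of_real y + of_real y ^ 2 / w)" for y :: real
  have der: "(F has_vector_derivative exp (- (of_real y * w)) * of_real (1 - y\<^sup>2)) (at y within S)" for y S
  proof -
    have "((\<lambda>x. exp (- (x * w)) * ((2 / w ^ 3 - 1 / w) + (2 / w ^ 2) * x + x ^ 2 / w))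
        has_field_derivative exp (- (of_real y * w)) * of_real (1 - y\<^sup>2)) (at (of_real y))"
      using w(1) by (auto intro!: derivative_eq_intros simp: field_simps power2_eq_square power3_eq_cube)
    from has_vector_derivative_real_field[OF this] show ?thesis
      unfolding F_def by (rule has_vector_derivative_at_within)
  qed
  have "bump_hat \<tau> = (\<integral>y. indicat_real {-1..1} y *\<^sub>R (exp (- (of_real y * w)) * of_real (1 - y\<^sup>2)) \<partial>lborel)"
    unfolding bump_hat_def
    by (rule Bochner_Integration.integral_cong)
       (auto simp: indicator_def bump_eq bump_eq_0 cis_conv_exp w_def mult.assoc mult.left_commute)
  also have "\<dots> = F 1 - F (-1)"
    by (rule integral_FTC_Icc[OF _ der]) (auto intro!: continuous_intros)
  finally have eq: "bump_hat \<tau> = F 1 - F (-1)" .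
  have "cmod (F y) \<le> 4 / \<tau>\<^sup>2" if "y = 1 \<or> y = -1" for y
  proof -
    have "F y = exp (- (of_real y * w)) * (2 / w ^ 3 + 2 * of_real y / w ^ 2)"
      using that by (auto simp: F_def)
    also have "cmod \<dots> = cmod (2 / w ^ 3 + 2 * of_real y / w ^ 2)"
      by (simp add: norm_mult w_def)
    also have "\<dots> \<le> cmod (2 / w ^ 3) + cmod (2 * of_real y / w ^ 2)"
      by (rule norm_triangle_ineq)
    also have "\<dots> = 2 / \<bar>\<tau>\<bar> ^ 3 + 2 / \<bar>\<tau>\<bar> ^ 2"
      using that by (auto simp: norm_divide norm_power norm_mult w(2))
    also have "\<dots> \<le> 2 / \<bar>\<tau>\<bar> ^ 2 + 2 / \<bar>\<tau>\<bar> ^ 2"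
      using False by (intro add_mono divide_left_mono power_increasing) auto
    finally show ?thesis by simp
  qed
  from this[of 1] this[of "-1"] have "cmod (bump_hat \<tau>) \<le> 8 / \<tau>\<^sup>2"
    using norm_triangle_ineq4[of "F 1" "F (-1)"] by (simp add: eq)
  also have "\<dots> \<le> 16 / (1 + \<tau>\<^sup>2)"
    using one_le_power[of "\<bar>\<tau>\<bar>" 2] False \<tau> by (simp add: field_simps add_pos_nonneg)
  finally show ?thesis .
qed

lemma integrable_lorentzian: "integrable lborel (\<lambda>\<tau>::real. 1 / (1 + \<tau>\<^sup>2))"
  using integrable_inverse_1_plus_square
  by (simp add: set_integrable_def inverse_eq_divide einterval_def)

section \<open>The trial functions\<close>

text \<open>
  For a speed \<open>v\<close> the parameters will be the sign \<open>s = \<plusminus>1\<close> of \<open>v\<close> and \<open>r = sqrt (1 - \<bar>v\<bar>)\<close>: a bump of width \<open>r\<close>,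
  modulated to the frequency \<open>- s / r\<^sup>2\<close>. There the symbol \<open>\<bar>\<eta>\<bar> + v \<eta>\<close> has the value
  \<open>(1 - \<bar>v\<bar>) / r\<^sup>2 = 1\<close>. The band width \<open>1 / r\<close> of the bump is much smaller than the distance \<open>1 / r\<^sup>2\<close> to the
  half-line \<open>s \<eta> > 0\<close>, on which the symbol is large.
\<close>

definition carrier_wave :: "real \<Rightarrow> real \<Rightarrow> real \<Rightarrow> complex" where
  "carrier_wave r s y = of_real (bump (y / r)) * cis (- (s * y / r\<^sup>2))"

definition carrier_wave_hat :: "real \<Rightarrow> real \<Rightarrow> real \<Rightarrow> complex" where
  "carrier_wave_hat r s \<eta> = of_real (r / sqrt (2 * pi)) * bump_hat (s / r + r * \<eta>)"

definition trial :: "real \<Rightarrow> real \<Rightarrow> real \<Rightarrow> real \<times> real \<Rightarrow> complex" where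
  "trial t r s z = of_real (t * bump (fst z)) * carrier_wave r s (snd z)"

definition trial_dx :: "real \<Rightarrow> real \<Rightarrow> real \<Rightarrow> real \<times> real \<Rightarrow> complex" where
  "trial_dx t r s z = of_real (t * bump' (fst z)) * carrier_wave r s (snd z)"

definition trial_hat :: "real \<Rightarrow> real \<Rightarrow> real \<Rightarrow> real \<times> real \<Rightarrow> complex" where
  "trial_hat t r s z = of_real (t * bump (fst z)) * carrier_wave_hat r s (snd z)"

lemma continuous_on_carrier_wave [continuous_intros]:
  "r \<noteq> 0 \<Longrightarrow> continuous_on S f \<Longrightarrow> continuous_on S (\<lambda>z. carrier_wave r s (f z))"
  unfolding carrier_wave_def cis_conv_exp by (intro continuous_intros) auto

lemma measurable_carrier_wave [measurable]: "carrier_wave r s \<in> borel_measurable borel"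
  unfolding carrier_wave_def cis_conv_exp by measurable

lemma measurable_carrier_wave_hat [measurable]: "carrier_wave_hat r s \<in> borel_measurable borel"
  unfolding carrier_wave_hat_def by measurable

lemma measurable_trial [measurable]:
  "trial t r s \<in> borel_measurable borel" "trial_dx t r s \<in> borel_measurable borel"
  "trial_hat t r s \<in> borel_measurable borel"
  unfolding trial_def trial_dx_def trial_hat_def borel_prod[symmetric] by measurable

lemma norm_carrier_wave [simp]: "cmod (carrier_wave r s y) = bump (y / r)"
  by (simp add: carrier_wave_def norm_mult)

lemma
  fixes f :: "real \<Rightarrow> real" assumes "0 < r" "integrable lborel f"
  shows integrable_dilated: "integrable lborel (\<lambda>y. f (y / r))"
    and integral_dilated: "(\<integral>y. f (y / r) \<partial>lborel) = r * (\<integral>y. f y \<partial>lborel)"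
  using lborel_integrable_real_affine[OF assms(2), of "1 / r" 0] assms(1)
    lborel_integral_real_affine[of "1 / r" f 0] by (auto simp: field_simps)

lemma
  assumes "0 < r"
  shows square_integrable_trial: "square_integrable (trial t r s)"
    and integral_trial_square: "(\<integral>z. (cmod (trial t r s z))\<^sup>2 \<partial>lborel)
        = t\<^sup>2 * (r * (\<integral>x. (bump x)\<^sup>2 \<partial>lborel)\<^sup>2)"
proof -
  have eq: "(\<lambda>z. (cmod (trial t r s z))\<^sup>2) = (\<lambda>z. (t\<^sup>2 * (bump (fst z))\<^sup>2) * (bump (snd z / r))\<^sup>2)"
    by (simp add: trial_def norm_mult power_mult_distrib fun_eq_iff)
  note i1 = integrable_bump_power[of 2, simplified]
  note i2 = integrable_mult_right[OF i1, of "t\<^sup>2"]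
  note i3 = integrable_dilated[OF assms i1]
  show "square_integrable (trial t r s)"
    using integrable_lborel_times[OF i2 i3] by (simp add: square_integrable_def eq)
  show "(\<integral>z. (cmod (trial t r s z))\<^sup>2 \<partial>lborel) = t\<^sup>2 * (r * (\<integral>x. (bump x)\<^sup>2 \<partial>lborel)\<^sup>2)"
    unfolding eq integral_lborel_times[OF i2 i3] integral_dilated[OF assms i1]
    by (simp add: power2_eq_square)
qed

lemma integral_trial_powr:
  assumes "0 < r" "0 < t" "0 < q"
  shows "(\<integral>z. cmod (trial t r s z) powr q \<partial>lborel)
        = t powr q * (r * (\<integral>x. bump x powr q \<partial>lborel)\<^sup>2)"
proof -
  have eq: "(\<lambda>z. cmod (trial t r s z) powr q)
      = (\<lambda>z. (t powr q * bump (fst z) powr q) * bump (snd z / r) powr q)"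
    using assms by (simp add: trial_def norm_mult powr_mult fun_eq_iff abs_mult)
  note i1 = integrable_bump_powr[OF assms(3)]
  note i2 = integrable_mult_right[OF i1, of "t powr q"]
  note i3 = integrable_dilated[OF assms(1) i1]
  show ?thesis
    unfolding eq integral_lborel_times[OF i2 i3] integral_dilated[OF assms(1) i1]
    by (simp add: power2_eq_square)
qed

lemma
  assumes "0 < r"
  shows square_integrable_trial_dx: "square_integrable (trial_dx t r s)"
    and integral_trial_dx_square: "(\<integral>z. (cmod (trial_dx t r s z))\<^sup>2 \<partial>lborel)
        = t\<^sup>2 * (r * ((\<integral>x. (bump' x)\<^sup>2 \<partial>lborel) * (\<integral>x. (bump x)\<^sup>2 \<partial>lborel)))"
proof -
  have eq: "(\<lambda>z. (cmod (trial_dx t r s z))\<^sup>2) = (\<lambda>z. (t\<^sup>2 * (bump' (fst z))\<^sup>2) * (bump (snd z / r))\<^sup>2)"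
    by (simp add: trial_dx_def norm_mult power_mult_distrib fun_eq_iff)
  note i1 = integrable_bump_power[of 2, simplified]
  note i2 = integrable_mult_right[OF integrable_bump'_square, of "t\<^sup>2"]
  note i3 = integrable_dilated[OF assms i1]
  show "square_integrable (trial_dx t r s)"
    using integrable_lborel_times[OF i2 i3] by (simp add: square_integrable_def eq)
  show "(\<integral>z. (cmod (trial_dx t r s z))\<^sup>2 \<partial>lborel)
      = t\<^sup>2 * (r * ((\<integral>x. (bump' x)\<^sup>2 \<partial>lborel) * (\<integral>x. (bump x)\<^sup>2 \<partial>lborel)))"
    unfolding eq integral_lborel_times[OF i2 i3] integral_dilated[OF assms i1]
    by simp
qed

text \<open>
  On each horizontal line this is integration by parts on \<open>[-1, 1]\<close>, without boundary terms since \<open>bump\<close>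
  vanishes at \<open>\<plusminus>1\<close>; Fubini's theorem does the rest.
\<close>

lemma has_weak_dx_trial:
  assumes r: "0 < r"
  shows "has_weak_dx (trial t r s) (trial_dx t r s)"
  unfolding has_weak_dx_def
proof (intro conjI allI impI)
  show "square_integrable (trial_dx t r s)"
    by (rule square_integrable_trial_dx[OF r])
  fix \<phi> assume \<phi>: "test_function \<phi>"
  let ?B = "carrier_wave r s"
  let ?K = "{-1..1::real} \<times> {-r..r}"
  have K: "compact ?K" by (intro compact_Times compact_Icc)
  have c\<phi>: "continuous_on UNIV \<phi>"
    using \<phi> by (meson continuous_at_imp_continuous_on differentiable_imp_continuous_within test_function_def)
  have cdx: "continuous_on UNIV (dx \<phi>)" using \<phi> by (simp add: test_function_def)
  have B0: "?B y = 0" if "y \<notin> {-r..r}" for y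
    using that r by (auto simp: carrier_wave_def bump_eq_0 not_le field_simps)
  have i1: "integrable lborel (\<lambda>z. trial t r s z * dx \<phi> z)"
  proof (rule integrable_compact_support[OF K])
    show "continuous_on ?K (\<lambda>z. trial t r s z * dx \<phi> z)"
      unfolding trial_def using r by (intro continuous_intros continuous_on_subset[OF cdx]) auto
    show "trial t r s z * dx \<phi> z = 0" if "z \<notin> ?K" for z
    proof -
      have "bump (fst z) = 0 \<or> carrier_wave r s (snd z) = 0"
        using that B0[of "snd z"] bump_eq_0[of "fst z"]
        by (cases "\<bar>fst z\<bar> \<le> 1") (auto simp: mem_Times_iff abs_le_iff)
      then show ?thesis by (auto simp: trial_def)
    qed
  qed
  have i2: "integrable lborel (\<lambda>z. trial_dx t r s z * \<phi> z)"
  proof (rule integrable_compact_support[OF K])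
    have "continuous_on ?K (\<lambda>z. of_real (t * (- 2 * fst z)) * ?B (snd z) * \<phi> z)"
      using r by (intro continuous_intros continuous_on_subset[OF c\<phi>]) auto
    then show "continuous_on ?K (\<lambda>z. trial_dx t r s z * \<phi> z)"
      by (rule continuous_on_eq) (auto simp: trial_dx_def bump'_def)
    show "trial_dx t r s z * \<phi> z = 0" if "z \<notin> ?K" for z
    proof -
      have "bump' (fst z) = 0 \<or> carrier_wave r s (snd z) = 0"
        using that B0[of "snd z"] by (cases "\<bar>fst z\<bar> \<le> 1") (auto simp: bump'_def mem_Times_iff abs_le_iff)
      then show ?thesis by (auto simp: trial_dx_def)
    qed
  qed
  have inner: "(\<integral>x. trial t r s (x, y) * dx \<phi> (x, y) \<partial>lborel)
      = - (\<integral>x. trial_dx t r s (x, y) * \<phi> (x, y) \<partial>lborel)" for y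
  proof -
    let ?f = "\<lambda>x. of_real (t * (1 - x\<^sup>2)) * ?B y * dx \<phi> (x, y)"
    let ?g = "\<lambda>x. of_real (t * (- 2 * x)) * ?B y * \<phi> (x, y)"
    have der\<phi>: "((\<lambda>x. \<phi> (x, y)) has_vector_derivative dx \<phi> (x, y)) (at x within S)" for x S
    proof -
      have "(\<phi> has_derivative frechet_derivative \<phi> (at (x, y))) (at (x, y))"
        using \<phi> by (simp add: test_function_def frechet_derivative_works[symmetric])
      then have "(\<phi> has_derivative frechet_derivative \<phi> (at (x, y))) (at (x, y) within (\<lambda>x. (x, y)) ` S)"
        by (rule has_derivative_at_withinI)
      moreover have "((\<lambda>x. (x, y)) has_vector_derivative (1, 0)) (at x within S)"
        by (intro has_vector_derivative_Pair has_vector_derivative_id has_vector_derivative_const)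
      ultimately have "((\<phi> \<circ> (\<lambda>x. (x, y))) has_vector_derivative frechet_derivative \<phi> (at (x, y)) (1, 0)) (at x within S)"
        by (rule vector_derivative_diff_chain_within[rotated])
      then show ?thesis by (simp add: o_def dx_def)
    qed
    have cf: "continuous_on {-1..1} ?f"
      by (intro continuous_intros continuous_on_compose2[OF cdx]) auto
    have cg: "continuous_on {-1..1} ?g"
      by (intro continuous_intros continuous_on_compose2[OF c\<phi>]) auto
    have "(\<integral>x. indicat_real {-1..1} x *\<^sub>R (?f x + ?g x) \<partial>lborel)
        = of_real (t * (1 - 1\<^sup>2)) * ?B y * \<phi> (1, y) - of_real (t * (1 - (-1)\<^sup>2)) * ?B y * \<phi> (-1, y)"
    proof (rule integral_FTC_Icc)
      fix x :: real
      show "((\<lambda>x. of_real (t * (1 - x\<^sup>2)) * ?B y * \<phi> (x, y)) has_vector_derivative ?f x + ?g x) (at x within {-1..1})"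
      proof -
        have "((\<lambda>x. complex_of_real (t * (1 - x\<^sup>2)) * ?B y) has_vector_derivative of_real (t * (- 2 * x)) * ?B y) (at x within {-1..1})"
          by (intro has_vector_derivative_mult_left has_vector_derivative_of_real)
             (auto intro!: derivative_eq_intros)
        from has_vector_derivative_mult[OF this der\<phi>] show ?thesis by simp
      qed
    qed (simp, rule continuous_on_add[OF cf cg])
    then have "(\<integral>x. indicat_real {-1..1} x *\<^sub>R ?f x \<partial>lborel) + (\<integral>x. indicat_real {-1..1} x *\<^sub>R ?g x \<partial>lborel) = 0"
      unfolding scaleR_add_right
        Bochner_Integration.integral_add[OF borel_integrable_compact[OF compact_Icc cf]
          borel_integrable_compact[OF compact_Icc cg]]
      by simp
    moreover have "(\<lambda>x. indicat_real {-1..1} x *\<^sub>R ?f x) = (\<lambda>x. trial t r s (x, y) * dx \<phi> (x, y))"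
      by (auto simp: fun_eq_iff trial_def indicator_def bump_eq bump_eq_0)
    moreover have "(\<lambda>x. indicat_real {-1..1} x *\<^sub>R ?g x) = (\<lambda>x. trial_dx t r s (x, y) * \<phi> (x, y))"
      by (auto simp: fun_eq_iff trial_dx_def indicator_def bump'_def)
    ultimately show ?thesis by (simp only: eq_neg_iff_add_eq_0)
  qed
  have "(\<integral>z. trial t r s z * dx \<phi> z \<partial>lborel) = (\<integral>y. (\<integral>x. trial t r s (x, y) * dx \<phi> (x, y) \<partial>lborel) \<partial>lborel)"
    using lborel_pair.integral_snd[of "\<lambda>x y. trial t r s (x, y) * dx \<phi> (x, y)"] i1 by (simp add: lborel_prod case_prod_beta')
  also have "\<dots> = - (\<integral>y. (\<integral>x. trial_dx t r s (x, y) * \<phi> (x, y) \<partial>lborel) \<partial>lborel)"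
    by (simp add: inner)
  also have "\<dots> = - (\<integral>z. trial_dx t r s z * \<phi> z \<partial>lborel)"
    using lborel_pair.integral_snd[of "\<lambda>x y. trial_dx t r s (x, y) * \<phi> (x, y)"] i2 by (simp add: lborel_prod case_prod_beta')
  finally show "(\<integral>z. trial t r s z * dx \<phi> z \<partial>lborel) = - (\<integral>z. trial_dx t r s z * \<phi> z \<partial>lborel)" .
qed

section \<open>The energy of the trial functions\<close>

text \<open>
  Because of the compact support the truncated integrals are constant from \<open>R = r\<close> on, so their limit
  is explicit. The formula is the substitution \<open>y \<rightarrow> r y\<close>.
\<close>

lemma fourier_y_trunc_trial:
  assumes r: "0 < r" and R: "r \<le> R"
  shows "fourier_y_trunc R (trial t r s) = trial_hat t r s"
proof
  fix z :: "real \<times> real"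
  obtain x \<eta> where z: "z = (x, \<eta>)" by fastforce
  let ?f = "\<lambda>y. cis (- (y * (s / r + r * \<eta>))) * complex_of_real (bump y)"
  have "(LINT y:{-R..R}|lborel. cis (- (y * \<eta>)) * trial t r s (x, y))
      = (\<integral>y. of_real (t * bump x) * ?f (0 + (1 / r) * y) \<partial>lborel)"
    unfolding set_lebesgue_integral_def
  proof (rule Bochner_Integration.integral_cong)
    fix y
    show "indicat_real {-R..R} y *\<^sub>R (cis (- (y * \<eta>)) * trial t r s (x, y))
        = of_real (t * bump x) * ?f (0 + (1 / r) * y)"
    proof (cases "y \<in> {-R..R}")
      case True
      have "- (y * \<eta>) + - (s * y / r\<^sup>2) = - ((1 / r) * y * (s / r + r * \<eta>))"
        using r by (simp add: field_simps power2_eq_square)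
      then have "cis (- (y * \<eta>)) * cis (- (s * y / r\<^sup>2)) = cis (- ((1 / r) * y * (s / r + r * \<eta>)))"
        by (simp only: cis_mult)
      then show ?thesis
        using True by (simp add: trial_def carrier_wave_def mult.assoc mult.left_commute)
    next
      case False
      have "bump (y / r) = 0" by (rule bump_eq_0) (use False r R in \<open>auto simp: field_simps\<close>)
      then show ?thesis using False by simp
    qed
  qed simp
  also have "\<dots> = of_real (t * bump x) * (\<integral>y. ?f (0 + (1 / r) * y) \<partial>lborel)"
    by (rule integral_mult_right_zero)
  also have "(\<integral>y. ?f (0 + (1 / r) * y) \<partial>lborel) = r *\<^sub>R (\<integral>y. ?f y \<partial>lborel)"
    using lborel_integral_real_affine[of "1 / r" ?f 0] r by simp
  also have "(\<integral>y. ?f y \<partial>lborel) = bump_hat (s / r + r * \<eta>)"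
    by (simp add: bump_hat_def)
  finally show "fourier_y_trunc R (trial t r s) z = trial_hat t r s z"
    by (simp add: z fourier_y_trunc_def trial_hat_def carrier_wave_hat_def scaleR_conv_of_real)
qed

lemma norm_carrier_wave_hat_square_le:
  assumes "0 < r"
  shows "(cmod (carrier_wave_hat r s \<eta>))\<^sup>2 \<le> r\<^sup>2 * (256 / (1 + (s / r + r * \<eta>)\<^sup>2)\<^sup>2)"
proof -
  let ?\<tau> = "s / r + r * \<eta>"
  have "1 \<le> sqrt (2 * pi)"
    using pi_gt3 by (simp add: real_le_rsqrt)
  then have "r / sqrt (2 * pi) \<le> r"
    using assms by (simp add: field_simps)
  then have "cmod (carrier_wave_hat r s \<eta>) \<le> r * (16 / (1 + ?\<tau>\<^sup>2))"
    unfolding carrier_wave_hat_def norm_mult norm_of_real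
    by (intro mult_mono norm_bump_hat_le) (use assms in auto)
  then have "(cmod (carrier_wave_hat r s \<eta>))\<^sup>2 \<le> (r * (16 / (1 + ?\<tau>\<^sup>2)))\<^sup>2"
    by (rule power_mono) simp
  then show ?thesis by (simp add: power_mult_distrib power_divide)
qed

text \<open>
  The remaining estimates compare everything with the Lorentzian \<open>1 / (1 + \<tau>\<^sup>2)\<close> in the rescaled frequency
  \<open>\<tau> = s / r + r \<eta>\<close>.
\<close>

lemma abs_le_one_plus_square: "\<bar>\<tau>\<bar> \<le> 1 + \<tau>\<^sup>2" for \<tau> :: real
proof -
  have "2 * \<bar>\<tau>\<bar> \<le> \<tau>\<^sup>2 + 1"
    using sum_squares_bound[of "\<bar>\<tau>\<bar>" 1] by simp
  then show ?thesis by linarith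
qed

text \<open>
  This is \<open>r (\<bar>\<eta>\<bar> + v \<eta>)\<close> in terms of \<open>\<tau> = s / r + r \<eta>\<close>. With \<open>m = s (\<tau> - s / r)\<close> it is at most
  \<open>r\<^sup>2 \<bar>m\<bar> + 2 max 0 m\<close>. The first term gains the factor \<open>r\<^sup>2 = 1 - \<bar>v\<bar>\<close>, of which the distance
  \<open>1 / r\<close> of the carrier frequency from 0 uses up one power. The second term is present only if
  \<open>\<bar>\<tau>\<bar> > 1 / r\<close>, and then \<open>m \<le> \<bar>\<tau>\<bar> \<le> r \<tau>\<^sup>2\<close>.
\<close>

lemma doppler_weight_le:
  fixes v r s \<tau> :: real
  assumes "0 < r" "r \<le> 1" and s: "\<bar>s\<bar> = 1" and v: "v = s * (1 - r\<^sup>2)"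
  shows "\<bar>\<tau> - s / r\<bar> + v * (\<tau> - s / r) \<le> 4 * r * (1 + \<tau>\<^sup>2)"
proof -
  define m where "m = s * (\<tau> - s / r)"
  have ss: "s * s = 1" using s by (metis abs_mult_self_eq mult_1)
  have m: "m = s * \<tau> - 1 / r" using ss by (simp add: m_def right_diff_distrib)
  have am: "\<bar>\<tau> - s / r\<bar> = \<bar>m\<bar>" by (simp add: m_def abs_mult s)
  have st: "\<bar>s * \<tau>\<bar> = \<bar>\<tau>\<bar>" by (simp add: abs_mult s)
  have sq: "\<bar>\<tau>\<bar> \<le> 1 + \<tau>\<^sup>2" "1 \<le> 1 + \<tau>\<^sup>2"
    using abs_le_one_plus_square by simp_all
  have "\<bar>m\<bar> \<le> \<bar>\<tau>\<bar> + 1 / r"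
    using abs_triangle_ineq4[of "s * \<tau>" "1 / r"] st assms(1) by (simp add: m)
  then have "r\<^sup>2 * \<bar>m\<bar> \<le> r\<^sup>2 * (\<bar>\<tau>\<bar> + 1 / r)" by (rule mult_left_mono) simp
  also have "\<dots> = r * (r * \<bar>\<tau>\<bar> + 1)" using assms(1) by (simp add: field_simps power2_eq_square)
  also have "\<dots> \<le> r * ((1 + \<tau>\<^sup>2) + (1 + \<tau>\<^sup>2))"
  proof (intro mult_left_mono add_mono)
    have "r * \<bar>\<tau>\<bar> \<le> 1 * \<bar>\<tau>\<bar>" by (intro mult_right_mono assms) simp
    then show "r * \<bar>\<tau>\<bar> \<le> 1 + \<tau>\<^sup>2" using sq by simp
  qed (use sq assms in auto)
  finally have A: "r\<^sup>2 * \<bar>m\<bar> \<le> 2 * r * (1 + \<tau>\<^sup>2)" by (simp add: algebra_simps)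
  have B: "max 0 m \<le> r * (1 + \<tau>\<^sup>2)"
  proof (cases "0 < m")
    case True
    then have "1 / r \<le> \<bar>\<tau>\<bar>" using st by (simp add: m)
    then have "1 \<le> r * \<bar>\<tau>\<bar>" using assms(1) by (simp add: field_simps)
    then have "1 * \<bar>\<tau>\<bar> \<le> (r * \<bar>\<tau>\<bar>) * \<bar>\<tau>\<bar>" by (rule mult_right_mono) simp
    then have "\<bar>\<tau>\<bar> \<le> r * \<tau>\<^sup>2" by (simp add: power2_eq_square mult.assoc)
    moreover have "m \<le> \<bar>\<tau>\<bar>" using st assms(1) by (simp add: m) (smt (verit) divide_pos_pos)
    ultimately show ?thesis using True assms(1) by (simp add: distrib_left)
  next
    case False
    then show ?thesis using assms(1) by (simp add: max_def)
  qed
  have "\<bar>\<tau> - s / r\<bar> + v * (\<tau> - s / r) = \<bar>m\<bar> + (1 - r\<^sup>2) * m"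
    by (simp add: am v m_def mult_ac)
  also have "\<dots> \<le> r\<^sup>2 * \<bar>m\<bar> + 2 * max 0 m"
    by (cases "0 < m") (auto simp: max_def algebra_simps)
  finally show ?thesis using A B by linarith
qed

lemma integral_dilated_lorentzian:
  fixes r s C :: real
  assumes "0 < r"
  shows "integrable lborel (\<lambda>\<eta>. C * (1 / (1 + (s / r + r * \<eta>)\<^sup>2)))"
    and "(\<integral>\<eta>. C * (1 / (1 + (s / r + r * \<eta>)\<^sup>2)) \<partial>lborel) = C / r * (\<integral>\<tau>. 1 / (1 + \<tau>\<^sup>2) \<partial>lborel)"
proof -
  show "integrable lborel (\<lambda>\<eta>. C * (1 / (1 + (s / r + r * \<eta>)\<^sup>2)))"
    using lborel_integrable_real_affine[OF integrable_lorentzian, of r "s / r"] assms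
    by (intro integrable_mult_right) simp
  have "(\<integral>\<eta>. 1 / (1 + (s / r + r * \<eta>)\<^sup>2) \<partial>lborel) = (\<integral>\<tau>. 1 / (1 + \<tau>\<^sup>2) \<partial>lborel) / r"
    using lborel_integral_real_affine[of r "\<lambda>\<tau>::real. 1 / (1 + \<tau>\<^sup>2)" "s / r"] assms
    by simp
  then show "(\<integral>\<eta>. C * (1 / (1 + (s / r + r * \<eta>)\<^sup>2)) \<partial>lborel) = C / r * (\<integral>\<tau>. 1 / (1 + \<tau>\<^sup>2) \<partial>lborel)"
    by (simp only: integral_mult_right_zero) simp
qed

lemma one_le_one_plus_square: "(1::real) \<le> 1 + \<tau>\<^sup>2" by simp

text \<open>
  For fixed \<open>r\<close> a crude bound \<open>\<bar>\<eta>\<bar> = O(1 + \<tau>\<^sup>2)\<close> suffices; uniformity in \<open>r\<close> matters only for the combined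
  weight \<open>\<bar>\<eta>\<bar> + v \<eta>\<close> further down.
\<close>

lemma integrable_carrier_wave_hat:
  assumes r: "0 < r" and s: "\<bar>s\<bar> = 1"
  shows "integrable lborel (\<lambda>\<eta>. (cmod (carrier_wave_hat r s \<eta>))\<^sup>2)"
    and "integrable lborel (\<lambda>\<eta>. \<bar>\<eta>\<bar> * (cmod (carrier_wave_hat r s \<eta>))\<^sup>2)"
proof -
  have le: "1 / (1 + \<tau>\<^sup>2)\<^sup>2 \<le> 1 / (1 + \<tau>\<^sup>2)" for \<tau> :: real
    by (rule divide_left_mono) (auto simp: power2_eq_square[of "1 + \<tau>\<^sup>2"] add_pos_nonneg zero_less_mult_iff)
  show "integrable lborel (\<lambda>\<eta>. (cmod (carrier_wave_hat r s \<eta>))\<^sup>2)"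
  proof (rule Bochner_Integration.integrable_bound[OF integral_dilated_lorentzian(1)[OF r]])
    show "AE \<eta> in lborel. norm ((cmod (carrier_wave_hat r s \<eta>))\<^sup>2)
        \<le> norm (r\<^sup>2 * 256 * (1 / (1 + (s / r + r * \<eta>)\<^sup>2)))"
    proof (intro AE_I2)
      fix \<eta> :: real
      let ?\<tau> = "s / r + r * \<eta>"
      have "(cmod (carrier_wave_hat r s \<eta>))\<^sup>2 \<le> r\<^sup>2 * 256 * (1 / (1 + ?\<tau>\<^sup>2)\<^sup>2)"
        using norm_carrier_wave_hat_square_le[OF r] by simp
      also have "\<dots> \<le> r\<^sup>2 * 256 * (1 / (1 + ?\<tau>\<^sup>2))"
        by (rule mult_left_mono[OF le]) simp
      finally show "norm ((cmod (carrier_wave_hat r s \<eta>))\<^sup>2) \<le> norm (r\<^sup>2 * 256 * (1 / (1 + ?\<tau>\<^sup>2)))"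
        by simp
    qed
  qed measurable
  show "integrable lborel (\<lambda>\<eta>. \<bar>\<eta>\<bar> * (cmod (carrier_wave_hat r s \<eta>))\<^sup>2)"
  proof (rule Bochner_Integration.integrable_bound[OF integral_dilated_lorentzian(1)[OF r]])
    show "AE \<eta> in lborel. norm (\<bar>\<eta>\<bar> * (cmod (carrier_wave_hat r s \<eta>))\<^sup>2)
        \<le> norm (r * (1 + 1 / r) * 256 * (1 / (1 + (s / r + r * \<eta>)\<^sup>2)))"
    proof (intro AE_I2)
      fix \<eta> :: real
      let ?\<tau> = "s / r + r * \<eta>"
      have "\<bar>r * \<eta>\<bar> = \<bar>?\<tau> - s / r\<bar>" by simp
      also have "\<dots> \<le> \<bar>?\<tau>\<bar> + \<bar>s / r\<bar>" by (rule abs_triangle_ineq4)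
      also have "\<dots> \<le> (1 + ?\<tau>\<^sup>2) + (1 + ?\<tau>\<^sup>2) * (1 / r)"
      proof (rule add_mono)
        show "\<bar>?\<tau>\<bar> \<le> 1 + ?\<tau>\<^sup>2" by (rule abs_le_one_plus_square)
        have "1 * (1 / r) \<le> (1 + ?\<tau>\<^sup>2) * (1 / r)"
          by (rule mult_right_mono[OF one_le_one_plus_square]) (use r in simp)
        then show "\<bar>s / r\<bar> \<le> (1 + ?\<tau>\<^sup>2) * (1 / r)" using s r by (simp add: abs_divide)
      qed
      finally have w: "r * \<bar>\<eta>\<bar> \<le> (1 + 1 / r) * (1 + ?\<tau>\<^sup>2)"
        using r by (simp add: abs_mult algebra_simps)
      have pos: "0 < 1 + ?\<tau>\<^sup>2" by (simp add: add_pos_nonneg)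
      have "\<bar>\<eta>\<bar> * (cmod (carrier_wave_hat r s \<eta>))\<^sup>2 \<le> \<bar>\<eta>\<bar> * (r\<^sup>2 * (256 / (1 + ?\<tau>\<^sup>2)\<^sup>2))"
        by (rule mult_left_mono[OF norm_carrier_wave_hat_square_le[OF r]]) simp
      also have "\<dots> = (r * \<bar>\<eta>\<bar>) * (r * (256 / (1 + ?\<tau>\<^sup>2)\<^sup>2))"
        by (simp add: power2_eq_square)
      also have "\<dots> \<le> ((1 + 1 / r) * (1 + ?\<tau>\<^sup>2)) * (r * (256 / (1 + ?\<tau>\<^sup>2)\<^sup>2))"
        by (rule mult_right_mono[OF w]) (use r in simp)
      also have "\<dots> = r * (1 + 1 / r) * 256 * (1 / (1 + ?\<tau>\<^sup>2))"
        using pos by (simp add: power2_eq_square[of "1 + ?\<tau>\<^sup>2"])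
      finally show "norm (\<bar>\<eta>\<bar> * (cmod (carrier_wave_hat r s \<eta>))\<^sup>2) \<le> norm (r * (1 + 1 / r) * 256 * (1 / (1 + ?\<tau>\<^sup>2)))"
        using r by simp
    qed
  qed measurable
qed

text \<open>
  The quadratic form of \<open>\<bar>D\<^sub>y\<bar> - i v \<partial>\<^sub>y\<close> at the carrier wave.
\<close>

definition doppler_energy :: "real \<Rightarrow> real \<Rightarrow> real \<Rightarrow> real" where
  "doppler_energy v r s = (\<integral>\<eta>. (\<bar>\<eta>\<bar> + v * \<eta>) * (cmod (carrier_wave_hat r s \<eta>))\<^sup>2 \<partial>lborel)"

lemma integrable_signed_weight:
  assumes "integrable M (\<lambda>z. \<bar>w z\<bar> * f z)" and [measurable]: "w \<in> borel_measurable M" "f \<in> borel_measurable M"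
  shows "integrable M (\<lambda>z. w z * (f z :: real))"
  by (rule Bochner_Integration.integrable_bound[OF assms(1)]) (auto simp: abs_mult)

lemma integrable_doppler:
  assumes "0 < r" "\<bar>s\<bar> = 1"
  shows "integrable lborel (\<lambda>\<eta>. (\<bar>\<eta>\<bar> + v * \<eta>) * (cmod (carrier_wave_hat r s \<eta>))\<^sup>2)"
proof -
  note i = integrable_carrier_wave_hat(2)[OF assms]
  have j: "integrable lborel (\<lambda>\<eta>. \<eta> * (cmod (carrier_wave_hat r s \<eta>))\<^sup>2)"
    by (rule integrable_signed_weight[OF i]) measurable
  show ?thesis
    using Bochner_Integration.integrable_add[OF i integrable_mult_right[OF j, of v]]
    by (simp add: distrib_right mult.assoc)
qed

text \<open>
  This is the point of the construction: although the carrier frequency is of size \<open>r\<^bsup>-2\<^esup>\<close>, the energy is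
  \<open>O(r)\<close>, like the square of the \<open>L\<^sup>2\<close> norm. Decay of the profile contributes \<open>r\<^sup>2 (1 + \<tau>\<^sup>2)\<^bsup>-2\<^esup>\<close>, the weight
  \<open>1 + \<tau>\<^sup>2\<close>, and passing from \<open>d\<eta>\<close> to \<open>d\<tau>\<close> costs \<open>1 / r\<close>.
\<close>

lemma
  assumes r: "0 < r" "r \<le> 1" and s: "\<bar>s\<bar> = 1" and v: "v = s * (1 - r\<^sup>2)"
  shows doppler_energy_nonneg: "0 \<le> doppler_energy v r s"
    and doppler_energy_le: "doppler_energy v r s \<le> r * (1024 * (\<integral>\<tau>. 1 / (1 + \<tau>\<^sup>2) \<partial>lborel))"
proof -
  have "r\<^sup>2 \<le> 1" using r by (simp add: power_le_one)
  then have "\<bar>v\<bar> \<le> 1" using v s by (simp add: abs_mult)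
  then have "\<bar>v * \<eta>\<bar> \<le> \<bar>\<eta>\<bar>" for \<eta>
    using mult_right_mono[of "\<bar>v\<bar>" 1 "\<bar>\<eta>\<bar>"] by (simp add: abs_mult)
  then have "0 \<le> \<bar>\<eta>\<bar> + v * \<eta>" for \<eta> by (smt (verit))
  then show "0 \<le> doppler_energy v r s"
    unfolding doppler_energy_def by (intro integral_nonneg_AE AE_I2 mult_nonneg_nonneg) auto
  have "doppler_energy v r s \<le> (\<integral>\<eta>. 1024 * r\<^sup>2 * (1 / (1 + (s / r + r * \<eta>)\<^sup>2)) \<partial>lborel)"
    unfolding doppler_energy_def
  proof (rule integral_mono[OF integrable_doppler[OF r(1) s] integral_dilated_lorentzian(1)[OF r(1)]])
    fix \<eta> :: real
    let ?\<tau> = "s / r + r * \<eta>"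
    have pos: "0 < 1 + ?\<tau>\<^sup>2" by (simp add: add_pos_nonneg)
    have "r * (\<bar>\<eta>\<bar> + v * \<eta>) = \<bar>?\<tau> - s / r\<bar> + v * (?\<tau> - s / r)"
      using r by (simp add: abs_mult algebra_simps)
    also have "\<dots> \<le> 4 * r * (1 + ?\<tau>\<^sup>2)" by (rule doppler_weight_le[OF r s v])
    finally have w: "r * (\<bar>\<eta>\<bar> + v * \<eta>) \<le> 4 * r * (1 + ?\<tau>\<^sup>2)" .
    have "(\<bar>\<eta>\<bar> + v * \<eta>) * (cmod (carrier_wave_hat r s \<eta>))\<^sup>2 \<le> (\<bar>\<eta>\<bar> + v * \<eta>) * (r\<^sup>2 * (256 / (1 + ?\<tau>\<^sup>2)\<^sup>2))"
      by (rule mult_left_mono[OF norm_carrier_wave_hat_square_le[OF r(1)]]) fact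
    also have "\<dots> = (r * (\<bar>\<eta>\<bar> + v * \<eta>)) * (r * (256 / (1 + ?\<tau>\<^sup>2)\<^sup>2))"
      by (simp add: power2_eq_square)
    also have "\<dots> \<le> (4 * r * (1 + ?\<tau>\<^sup>2)) * (r * (256 / (1 + ?\<tau>\<^sup>2)\<^sup>2))"
      by (rule mult_right_mono[OF w]) (use r in simp)
    also have "\<dots> = 1024 * r\<^sup>2 * (1 / (1 + ?\<tau>\<^sup>2))"
      using pos by (simp add: power2_eq_square[of "1 + ?\<tau>\<^sup>2"] power2_eq_square[of r])
    finally show "(\<bar>\<eta>\<bar> + v * \<eta>) * (cmod (carrier_wave_hat r s \<eta>))\<^sup>2 \<le> 1024 * r\<^sup>2 * (1 / (1 + ?\<tau>\<^sup>2))" .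
  qed
  also have "\<dots> = r * (1024 * (\<integral>\<tau>. 1 / (1 + \<tau>\<^sup>2) \<partial>lborel))"
    unfolding integral_dilated_lorentzian(2)[OF r(1)] using r by (simp add: power2_eq_square)
  finally show "doppler_energy v r s \<le> r * (1024 * (\<integral>\<tau>. 1 / (1 + \<tau>\<^sup>2) \<partial>lborel))" .
qed

lemma
  fixes w :: "real \<Rightarrow> real"
  assumes [measurable]: "w \<in> borel_measurable borel"
    and int: "integrable lborel (\<lambda>\<eta>. w \<eta> * (cmod (carrier_wave_hat r s \<eta>))\<^sup>2)"
  shows integrable_weighted_trial_hat: "integrable lborel (\<lambda>z. w (snd z) * (cmod (trial_hat t r s z))\<^sup>2)"
    and integral_weighted_trial_hat: "(\<integral>z. w (snd z) * (cmod (trial_hat t r s z))\<^sup>2 \<partial>lborel)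
      = t\<^sup>2 * ((\<integral>x. (bump x)\<^sup>2 \<partial>lborel) * (\<integral>\<eta>. w \<eta> * (cmod (carrier_wave_hat r s \<eta>))\<^sup>2 \<partial>lborel))"
proof -
  have eq: "(\<lambda>z. w (snd z) * (cmod (trial_hat t r s z))\<^sup>2)
      = (\<lambda>z. (t\<^sup>2 * (bump (fst z))\<^sup>2) * (w (snd z) * (cmod (carrier_wave_hat r s (snd z)))\<^sup>2))"
    by (simp add: trial_hat_def norm_mult power_mult_distrib fun_eq_iff)
  note i2 = integrable_mult_right[OF integrable_bump_power[of 2, simplified], of "t\<^sup>2"]
  show "integrable lborel (\<lambda>z. w (snd z) * (cmod (trial_hat t r s z))\<^sup>2)"
    unfolding eq by (rule integrable_lborel_times[OF i2 int])
  show "(\<integral>z. w (snd z) * (cmod (trial_hat t r s z))\<^sup>2 \<partial>lborel)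
      = t\<^sup>2 * ((\<integral>x. (bump x)\<^sup>2 \<partial>lborel) * (\<integral>\<eta>. w \<eta> * (cmod (carrier_wave_hat r s \<eta>))\<^sup>2 \<partial>lborel))"
    unfolding eq integral_lborel_times[OF i2 int] by simp
qed

lemma has_fourier_y_trial:
  assumes "0 < r" "\<bar>s\<bar> = 1"
  shows "has_fourier_y (trial t r s) (trial_hat t r s)"
  unfolding has_fourier_y_def
proof
  show "square_integrable (trial_hat t r s)"
    using integrable_weighted_trial_hat[of "\<lambda>_. 1" r s t] integrable_carrier_wave_hat(1)[OF assms]
    by (simp add: square_integrable_def)
  show "((\<lambda>R. \<integral>\<^sup>+z. ennreal ((cmod (fourier_y_trunc R (trial t r s) z - trial_hat t r s z))\<^sup>2) \<partial>lborel) \<longlongrightarrow> 0) at_top"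
    using eventually_ge_at_top[of r]
    by (intro tendsto_eventually, elim eventually_mono) (simp add: fourier_y_trunc_trial[OF assms(1)])
qed

lemma trial_in_space_X:
  assumes "0 < r" "\<bar>s\<bar> = 1"
  shows "trial t r s \<in> space_X"
proof -
  have "integrable lborel (\<lambda>(x, \<eta>). \<bar>\<eta>\<bar> * (cmod (trial_hat t r s (x, \<eta>)))\<^sup>2)"
    using integrable_weighted_trial_hat[OF _ integrable_carrier_wave_hat(2)[OF assms], of t]
    by (simp add: case_prod_beta')
  then show ?thesis
    using square_integrable_trial[OF assms(1)] has_weak_dx_trial[OF assms(1)] has_fourier_y_trial[OF assms]
    unfolding space_X_def by blast
qed

section \<open>The functionals\<close>

lemma form_Dy_diag: "form_Dy u u = of_real (\<integral>z. \<bar>snd z\<bar> * (cmod (fourier_y u z))\<^sup>2 \<partial>lborel)"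
  and form_dy_diag: "form_dy u u = of_real (\<integral>z. snd z * (cmod (fourier_y u z))\<^sup>2 \<partial>lborel)"
  unfolding form_Dy_def form_dy_def integral_complex_of_real[symmetric]
  by (auto intro!: Bochner_Integration.integral_cong simp: mult.assoc simp flip: complex_norm_square)

text \<open>
  The quadratic part at amplitude 1, term by term: the square of the norm of \<open>\<partial>\<^sub>x\<close>, the form of
  \<open>\<bar>D\<^sub>y\<bar> - i v \<partial>\<^sub>y\<close>, and the mass.
\<close>

definition trial_form :: "real \<Rightarrow> real \<Rightarrow> real \<Rightarrow> real \<Rightarrow> real" where
  "trial_form \<omega> v r s =
     r * ((\<integral>x. (bump' x)\<^sup>2 \<partial>lborel) * (\<integral>x. (bump x)\<^sup>2 \<partial>lborel))
     + (\<integral>x. (bump x)\<^sup>2 \<partial>lborel) * doppler_energy v r s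
     + \<omega> * (r * (\<integral>x. (bump x)\<^sup>2 \<partial>lborel)\<^sup>2)"

lemma quadratic_part_trial:
  assumes "0 < r" "\<bar>s\<bar> = 1"
  shows "quadratic_part \<omega> v (trial t r s) = t\<^sup>2 * trial_form \<omega> v r s"
proof -
  let ?u = "trial t r s" and ?c = "\<integral>x. (bump x)\<^sup>2 \<partial>lborel"
  let ?w = "\<lambda>\<eta>. (cmod (carrier_wave_hat r s \<eta>))\<^sup>2"
  have dx: "has_weak_dx ?u (weak_dx ?u)"
    unfolding weak_dx_def by (rule someI[where P="has_weak_dx ?u", OF has_weak_dx_trial[OF assms(1)]])
  have hat: "has_fourier_y ?u (fourier_y ?u)"
    unfolding fourier_y_def by (rule someI[where P="has_fourier_y ?u", OF has_fourier_y_trial[OF assms]])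
  have [measurable]: "weak_dx ?u \<in> borel_measurable borel" "fourier_y ?u \<in> borel_measurable borel"
    using dx hat by (auto simp: has_weak_dx_def has_fourier_y_def square_integrable_def)
  have [measurable]: "snd \<in> borel_measurable (borel :: (real \<times> real) measure)"
    by (intro borel_measurable_continuous_onI continuous_intros)
  have "(\<integral>z. (cmod (weak_dx ?u z))\<^sup>2 \<partial>lborel) = (\<integral>z. (cmod (trial_dx t r s z))\<^sup>2 \<partial>lborel)"
    by (rule integral_cong_AE) (use weak_dx_AE[OF has_weak_dx_trial[OF assms(1), of t s]] in \<open>auto elim!: eventually_mono\<close>)
  then have 1: "(\<integral>z. (cmod (weak_dx ?u z))\<^sup>2 \<partial>lborel) = t\<^sup>2 * (r * ((\<integral>x. (bump' x)\<^sup>2 \<partial>lborel) * ?c))"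
    by (simp add: integral_trial_dx_square[OF assms(1)])
  have AE: "AE z in lborel. fourier_y ?u z = trial_hat t r s z"
    by (rule fourier_y_AE[OF _ has_fourier_y_trial[OF assms]]) simp
  have i1: "integrable lborel (\<lambda>\<eta>. \<bar>\<eta>\<bar> * ?w \<eta>)"
    by (rule integrable_carrier_wave_hat(2)[OF assms])
  have i2: "integrable lborel (\<lambda>\<eta>. \<eta> * ?w \<eta>)"
    by (rule integrable_signed_weight[OF i1]) measurable
  have "(\<integral>z. \<bar>snd z\<bar> * (cmod (fourier_y ?u z))\<^sup>2 \<partial>lborel) = (\<integral>z. \<bar>snd z\<bar> * (cmod (trial_hat t r s z))\<^sup>2 \<partial>lborel)"
    by (rule integral_cong_AE) (use AE in \<open>auto elim!: eventually_mono\<close>)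
  then have 2: "(\<integral>z. \<bar>snd z\<bar> * (cmod (fourier_y ?u z))\<^sup>2 \<partial>lborel) = t\<^sup>2 * (?c * (\<integral>\<eta>. \<bar>\<eta>\<bar> * ?w \<eta> \<partial>lborel))"
    by (simp add: integral_weighted_trial_hat[OF _ i1])
  have "(\<integral>z. snd z * (cmod (fourier_y ?u z))\<^sup>2 \<partial>lborel) = (\<integral>z. snd z * (cmod (trial_hat t r s z))\<^sup>2 \<partial>lborel)"
    by (rule integral_cong_AE) (use AE in \<open>auto elim!: eventually_mono\<close>)
  then have 3: "(\<integral>z. snd z * (cmod (fourier_y ?u z))\<^sup>2 \<partial>lborel) = t\<^sup>2 * (?c * (\<integral>\<eta>. \<eta> * ?w \<eta> \<partial>lborel))"
    by (simp add: integral_weighted_trial_hat[OF _ i2])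
  have 4: "doppler_energy v r s = (\<integral>\<eta>. \<bar>\<eta>\<bar> * ?w \<eta> \<partial>lborel) + v * (\<integral>\<eta>. \<eta> * ?w \<eta> \<partial>lborel)"
    unfolding doppler_energy_def distrib_right mult.assoc
    using i1 i2 by simp
  show ?thesis
    unfolding quadratic_part_def form_Dy_diag form_dy_diag Re_complex_of_real 1 2 3
      integral_trial_square[OF assms(1)] trial_form_def 4
    by (simp add: algebra_simps)
qed

text \<open>
  For such \<open>v\<close> one has \<open>\<bar>v \<eta>\<bar> \<le> \<bar>\<eta>\<bar>\<close>, so the two terms in \<open>y\<close> together are nonnegative.
\<close>

lemma quadratic_part_ge:
  assumes "\<bar>v\<bar> \<le> 1"
  shows "(\<integral>z. (cmod (weak_dx u z))\<^sup>2 \<partial>lborel) + \<omega> * (\<integral>z. (cmod (u z))\<^sup>2 \<partial>lborel) \<le> quadratic_part \<omega> v u"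
proof -
  have "\<bar>\<integral>z. snd z * (cmod (fourier_y u z))\<^sup>2 \<partial>lborel\<bar> \<le> (\<integral>z. \<bar>snd z\<bar> * (cmod (fourier_y u z))\<^sup>2 \<partial>lborel)"
    using integral_norm_bound[of lborel "\<lambda>z. snd z * (cmod (fourier_y u z))\<^sup>2"] by (simp add: abs_mult)
  then have le: "\<bar>Re (form_dy u u)\<bar> \<le> Re (form_Dy u u)"
    by (simp add: form_Dy_diag form_dy_diag)
  have "\<bar>v\<bar> * \<bar>Re (form_dy u u)\<bar> \<le> 1 * \<bar>Re (form_dy u u)\<bar>"
    by (rule mult_right_mono[OF assms]) simp
  with le have "\<bar>v * Re (form_dy u u)\<bar> \<le> Re (form_Dy u u)"
    by (simp add: abs_mult)
  then have "0 \<le> Re (form_Dy u u) + v * Re (form_dy u u)"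
    by linarith
  then show ?thesis by (simp add: quadratic_part_def)
qed

lemma quadratic_part_nonneg: "\<bar>v\<bar> \<le> 1 \<Longrightarrow> 0 \<le> \<omega> \<Longrightarrow> 0 \<le> quadratic_part \<omega> v u"
  by (rule order_trans[OF _ quadratic_part_ge]) simp_all

lemma action_S_if_nehari_N_zero:
  assumes "nehari_N p \<omega> v u = 0"
  shows "action_S p \<omega> v u = (1 / 2 - 1 / (p + 1)) * quadratic_part \<omega> v u"
  using assms by (simp add: action_S_def nehari_N_def left_diff_distrib)

text \<open>
  Test the equation with the solution itself.
\<close>

lemma nehari_N_zero_if_solution:
  assumes "is_solution p \<omega> v u" "1 < p"
  shows "nehari_N p \<omega> v u = 0"
proof -
  have powr: "x powr (p - 1) * x * x = x powr (p + 1)" if "0 \<le> x" for x :: real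
  proof (cases "x = 0")
    case False
    then have "x powr (p + 1) = x powr (p - 1) * x powr 2"
      by (simp add: add.commute flip: powr_add)
    then show ?thesis using that False by (simp add: power2_eq_square)
  qed (use assms(2) in simp)
  have 1: "of_real (cmod w powr (p - 1)) * w * cnj w = complex_of_real (cmod w powr (p + 1))" for w
  proof -
    have "of_real (cmod w powr (p - 1)) * w * cnj w = of_real (cmod w powr (p - 1)) * of_real ((cmod w)\<^sup>2)"
      by (simp only: mult.assoc complex_norm_square)
    also have "\<dots> = of_real (cmod w powr (p - 1) * cmod w * cmod w)"
      by (simp add: power2_eq_square)
    also have "cmod w powr (p - 1) * cmod w * cmod w = cmod w powr (p + 1)"
      by (rule powr) simp
    finally show ?thesis .
  qed
  have "(\<integral>z. weak_dx u z * cnj (weak_dx u z) \<partial>lborel) + form_Dy u u + of_real v * form_dy u u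
      + of_real \<omega> * (\<integral>z. u z * cnj (u z) \<partial>lborel)
      - (\<integral>z. of_real (cmod (u z) powr (p - 1)) * u z * cnj (u z) \<partial>lborel) = 0"
    using assms(1) unfolding is_solution_def by blast
  then have "Re (of_real (\<integral>z. (cmod (weak_dx u z))\<^sup>2 \<partial>lborel) + form_Dy u u + of_real v * form_dy u u
      + of_real \<omega> * of_real (\<integral>z. (cmod (u z))\<^sup>2 \<partial>lborel)
      - of_real (\<integral>z. cmod (u z) powr (p + 1) \<partial>lborel)) = 0"
    unfolding 1 complex_norm_square[symmetric] integral_complex_of_real by simp
  then show ?thesis by (simp add: nehari_N_def quadratic_part_def)
qed

lemma ground_level_le_action:
  assumes "\<bar>v\<bar> < 1" "0 < \<omega>" "1 < p" "u \<in> space_X" "nontrivial u" "nehari_N p \<omega> v u = 0"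
  shows "ground_level p \<omega> v \<le> action_S p \<omega> v u"
  unfolding ground_level_def
proof (rule cInf_lower)
  have "0 \<le> action_S p \<omega> v w" if "nehari_N p \<omega> v w = 0" for w
    unfolding action_S_if_nehari_N_zero[OF that] using assms
    by (intro mult_nonneg_nonneg quadratic_part_nonneg) (auto simp: field_simps)
  then show "bdd_below (action_S p \<omega> v ` {u \<in> space_X. nontrivial u \<and> nehari_N p \<omega> v u = 0})"
    by (intro bdd_belowI[of _ 0]) auto
qed (use assms in auto)

section \<open>The ground level as the speed tends to 1\<close>

text \<open>
  With \<open>r = sqrt (1 - \<bar>v\<bar>)\<close> and a trial function of amplitude \<open>t\<close>, the quadratic part is \<open>t\<^sup>2 A\<close> with
  \<open>A = O(r)\<close>, and the \<open>L\<^bsup>p+1\<^esup>\<close> term is \<open>t\<^bsup>p+1\<^esup> r B\<close>. The constraint fixes \<open>t\<^bsup>p-1\<^esup> = A / (r B)\<close>, which stays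
  bounded, and the action is then a multiple of \<open>t\<^sup>2 A = O(r)\<close>.
\<close>

lemma ground_level_le_sqrt:
  fixes \<omega> p :: real
  assumes \<omega>: "0 < \<omega>" and p: "1 < p"
  obtains C where "\<And>v. \<bar>v\<bar> < 1 \<Longrightarrow> ground_level p \<omega> v \<le> C * sqrt (1 - \<bar>v\<bar>)"
proof -
  define c where "c = (\<integral>x. (bump x)\<^sup>2 \<partial>lborel)"
  define B where "B = (\<integral>x. bump x powr (p + 1) \<partial>lborel)\<^sup>2"
  define K where "K = (\<integral>x. (bump' x)\<^sup>2 \<partial>lborel) * c + c * (1024 * (\<integral>\<tau>. 1 / (1 + \<tau>\<^sup>2) \<partial>lborel)) + \<omega> * c\<^sup>2"
  define T where "T = (K / B) powr (1 / (p - 1))"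
  have c: "0 < c" using integral_bump_powr_pos[of 2] by (simp add: c_def)
  have B: "0 < B" using integral_bump_powr_pos[of "p + 1"] p by (simp add: B_def)
  have "ground_level p \<omega> v \<le> (1 / 2 - 1 / (p + 1)) * (T\<^sup>2 * K) * sqrt (1 - \<bar>v\<bar>)" if v: "\<bar>v\<bar> < 1" for v
  proof -
    define r where "r = sqrt (1 - \<bar>v\<bar>)"
    define s :: real where "s = (if 0 \<le> v then 1 else - 1)"
    define A where "A = trial_form \<omega> v r s"
    define t where "t = (A / (r * B)) powr (1 / (p - 1))"
    let ?u = "trial t r s"
    have r: "0 < r" "r \<le> 1" using v by (auto simp: r_def)
    have s: "\<bar>s\<bar> = 1" by (simp add: s_def)
    have vs: "v = s * (1 - r\<^sup>2)" using v by (auto simp: r_def s_def)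
    have "0 < \<omega> * (r * c\<^sup>2)" using \<omega> r c by simp
    moreover have "0 \<le> r * ((\<integral>x. (bump' x)\<^sup>2 \<partial>lborel) * c)" using r c by simp
    moreover have "0 \<le> c * doppler_energy v r s"
      using doppler_energy_nonneg[OF r s vs] c by simp
    ultimately have A: "0 < A" by (simp add: A_def trial_form_def c_def)
    have "c * doppler_energy v r s \<le> c * (r * (1024 * (\<integral>\<tau>. 1 / (1 + \<tau>\<^sup>2) \<partial>lborel)))"
      using doppler_energy_le[OF r s vs] c by simp
    then have AK: "A \<le> K * r"
      by (simp add: A_def trial_form_def K_def flip: c_def) (simp add: algebra_simps)
    have t: "0 < t" using A r B by (simp add: t_def)
    have "A / (r * B) \<le> K / B" using AK r B by (simp add: field_simps)
    then have tT: "t \<le> T" unfolding t_def T_def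
      using A r B p by (intro powr_mono2) auto
    have "t powr (p - 1) = A / (r * B)" using A r B p by (simp add: t_def powr_powr)
    then have "t powr (p - 1) * t powr 2 * (r * B) = t\<^sup>2 * A" using r B t by (simp add: field_simps)
    then have L: "t powr (p + 1) * (r * B) = t\<^sup>2 * A" by (simp add: add.commute flip: powr_add)
    have Q: "quadratic_part \<omega> v ?u = t\<^sup>2 * A"
      by (simp add: quadratic_part_trial[OF r(1) s] A_def)
    have N: "nehari_N p \<omega> v ?u = 0"
      using integral_trial_powr[OF r(1) t, of "p + 1" s] p L by (simp add: nehari_N_def Q B_def)
    have "nontrivial ?u"
      unfolding nontrivial_def
    proof
      assume AE0: "AE z in lborel. ?u z = 0"
      have "(\<integral>z. (cmod (?u z))\<^sup>2 \<partial>lborel) = 0"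
        by (rule integral_eq_zero_AE) (use AE0 in \<open>auto elim: eventually_mono\<close>)
      then show False using integral_trial_square[OF r(1), of t s] t r c by (simp add: c_def)
    qed
    then have "ground_level p \<omega> v \<le> (1 / 2 - 1 / (p + 1)) * (t\<^sup>2 * A)"
      using ground_level_le_action[OF v \<omega> p trial_in_space_X[OF r(1) s] _ N]
      by (simp add: action_S_if_nehari_N_zero[OF N] Q)
    also have "\<dots> \<le> (1 / 2 - 1 / (p + 1)) * (T\<^sup>2 * (K * r))"
      using tT t A AK p by (intro mult_left_mono mult_mono power_mono) (auto simp: field_simps)
    finally show ?thesis by (simp add: r_def mult.assoc)
  qed
  then show ?thesis by (rule that)
qed

theorem theorem1p5:
  fixes \<omega> p :: real and Q :: "real \<Rightarrow> real \<times> real \<Rightarrow> complex"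
  assumes "\<omega> > 0" and "1 < p" and "p < 5"
    and "\<And>v. \<bar>v\<bar> < 1 \<Longrightarrow> Q v \<in> space_X"
    and "\<And>v. \<bar>v\<bar> < 1 \<Longrightarrow> nontrivial (Q v)"
    and "\<And>v. \<bar>v\<bar> < 1 \<Longrightarrow> is_solution p \<omega> v (Q v)"
    and "\<And>v. \<bar>v\<bar> < 1 \<Longrightarrow> action_S p \<omega> v (Q v) = ground_level p \<omega> v"
  shows "((\<lambda>v. l2_norm (weak_dx (Q v))) \<longlongrightarrow> 0) (filtercomap abs (at_left 1)) \<and>
         ((\<lambda>v. l2_norm (Q v)) \<longlongrightarrow> 0) (filtercomap abs (at_left 1))"
proof -
  obtain C where C: "\<And>v. \<bar>v\<bar> < 1 \<Longrightarrow> ground_level p \<omega> v \<le> C * sqrt (1 - \<bar>v\<bar>)"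
    using ground_level_le_sqrt[OF assms(1,2)] by metis
  define k where "k = 1 / 2 - 1 / (p + 1)"
  have k: "0 < k" using assms(2) by (simp add: k_def field_simps)
  define b where "b w = C / k * sqrt (1 - w)" for w :: real
  have energy: "(\<integral>z. (cmod (weak_dx (Q v) z))\<^sup>2 \<partial>lborel) + \<omega> * (\<integral>z. (cmod (Q v z))\<^sup>2 \<partial>lborel) \<le> b \<bar>v\<bar>"
    if v: "\<bar>v\<bar> < 1" for v
  proof -
    have "k * quadratic_part \<omega> v (Q v) = ground_level p \<omega> v"
      using action_S_if_nehari_N_zero[OF nehari_N_zero_if_solution[OF assms(6)[OF v] assms(2)]] assms(7)[OF v]
      by (simp add: k_def)
    with C[OF v] have "quadratic_part \<omega> v (Q v) \<le> b \<bar>v\<bar>"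
      using k by (simp add: b_def field_simps)
    then show ?thesis
      using quadratic_part_ge[of v "Q v" \<omega>] v by simp
  qed
  have "((\<lambda>w. b w) \<longlongrightarrow> C / k * sqrt (1 - 1)) (at_left 1)"
    unfolding b_def by (intro tendsto_intros)
  then have "(b \<longlongrightarrow> 0) (at_left 1)" by simp
  then have b: "((\<lambda>v. b \<bar>v\<bar>) \<longlongrightarrow> 0) (filtercomap abs (at_left 1))"
    by (rule filterlim_compose[OF _ filterlim_filtercomap])
  have near: "\<forall>\<^sub>F v in filtercomap abs (at_left 1). \<bar>v\<bar> < (1::real)"
    by (auto simp: eventually_filtercomap eventually_at_filter intro!: exI[of _ "\<lambda>w. w < 1"])
  have "((\<lambda>v. sqrt (b \<bar>v\<bar>)) \<longlongrightarrow> 0) (filtercomap abs (at_left 1))"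
    using tendsto_real_sqrt[OF b] by simp
  then have 1: "((\<lambda>v. l2_norm (weak_dx (Q v))) \<longlongrightarrow> 0) (filtercomap abs (at_left 1))"
  proof (rule Lim_null_comparison[rotated])
    show "\<forall>\<^sub>F v in filtercomap abs (at_left 1). norm (l2_norm (weak_dx (Q v))) \<le> sqrt (b \<bar>v\<bar>)"
      using near
    proof eventually_elim
      case (elim v)
      have "0 \<le> \<omega> * (\<integral>z. (cmod (Q v z))\<^sup>2 \<partial>lborel)" using assms(1) by simp
      then show ?case using energy[OF elim] by (simp add: l2_norm_def)
    qed
  qed
  have "((\<lambda>v. sqrt (b \<bar>v\<bar> / \<omega>)) \<longlongrightarrow> 0) (filtercomap abs (at_left 1))"
    using tendsto_real_sqrt[OF tendsto_divide[OF b tendsto_const[of \<omega>]]] assms(1) by simp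
  then have 2: "((\<lambda>v. l2_norm (Q v)) \<longlongrightarrow> 0) (filtercomap abs (at_left 1))"
  proof (rule Lim_null_comparison[rotated])
    show "\<forall>\<^sub>F v in filtercomap abs (at_left 1). norm (l2_norm (Q v)) \<le> sqrt (b \<bar>v\<bar> / \<omega>)"
      using near
    proof eventually_elim
      case (elim v)
      have "0 \<le> (\<integral>z. (cmod (weak_dx (Q v) z))\<^sup>2 \<partial>lborel)" by simp
      then have "\<omega> * (\<integral>z. (cmod (Q v z))\<^sup>2 \<partial>lborel) \<le> b \<bar>v\<bar>"
        using energy[OF elim] by linarith
      then show ?case using assms(1) by (simp add: l2_norm_def field_simps)
    qed
  qed
  from 1 2 show ?thesis ..
qed

end
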